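(* Let $n\ge2$, let $m_1,\dots,m_n\ge0$ be integers, $\mathrm{m}=(m_1,\dots,m_n)$, $|\mathrm{m}|=\sum_k m_k$, and let $z_0\in\mathbb{C}$ be a constant. Let $c_{k,k+1}$ ($k=1,\dots,n$, with $c_{n,n+1}=c_{n,1}$) be generic constants (in particular $\sum_{k=1}^n c_{k,k+1}\notin\Lambda_\tau$), and let $s_{k,k+1}=c_{k,k+1}+z_k-z_{k+1}$ for $k=1,\dots,n$, with $z_{n+1}:=z_1$, where $z_1,\dots,z_n$ are the linear coordinates on $E^n$. Define $$\xi_{\mathrm{chain}}=\prod_{k=1}^{n-1}\widehat e_{m_k}(s_{k,k+1})\cdot\widehat e_{m_n}(z_n-z_0),\qquad \xi_{\mathrm{loop}}=\prod_{k=1}^{n}\widehat e_{m_k}(s_{k,k+1}).$$ (i) The iterated holomorphic residues (taken first in $z_1$, then $z_2$, ..., then $z_n$) are $$\mathrm{res}_\partial(\xi_{\mathrm{chain}}\,dz_1\cdots dz_n)=\prod_{k=1}^n\delta_{m_k,1},\qquad \mathrm{res}_\partial(\xi_{\mathrm{loop}}\,dz_1\cdots dz_n)=0.$$ (ii) The regularized integrals over $E^n$ are $$\mathrm{reg}\!\int_{E^n}\xi_{\mathrm{chain}}\bigwedge_{k=1}^n\mathrm{vol}_k=\prod_{k=1}^n\delta_{m_k,0},$$ $$\mathrm{reg}\!\int_{E^n}\xi_{\mathrm{loop}}\bigwedge_{k=1}^n\mathrm{vol}_k=\widehat e_{|\mathrm{m}|}\Big(\sum_{k=1}^n s_{k,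k+1}\Big)\cdot\Big(\prod_{k=1}^n\delta_{m_k,0}-\prod_{k=1}^n(\delta_{m_k,0}-1)\Big).$$
   Context: **Setting.** $\tau\in\mathbb{C}$ with $\mathrm{im}\,\tau>0$, $\Lambda_\tau=\mathbb{Z}\oplus\mathbb{Z}\tau$, $E=\mathbb{C}/\Lambda_\tau$ with linear coordinate $z$, $\mathrm{vol}=\frac{\mathbf{i}}{2\,\mathrm{im}\,\tau}dz\wedge d\bar z$; $\mathrm{vol}_k$ is the copy in the variable $z_k$. **Functions $\widehat e_m$.** $\theta$ is the entire odd function with simple zeros exactly at $\Lambda_\tau$, $\theta'(0)=1$, $\theta(z+1)=-\theta(z)$, $\theta(z+\tau)=-e^{-\pi\mathbf{i}\tau}e^{-2\pi\mathbf{i}z}\theta(z)$. Put $A(z)=2\pi\mathbf{i}\,\frac{\bar z-z}{\bar\tau-\tau}$. The functions $\widehat e_m(z)$, $m\ge0$, are defined by the Laurent expansion in $c$ at $c=0$: $$e^{cA(z)}\frac{\theta(z+c)}{\theta(z)\theta(c)}=\frac1c\sum_{m\ge0}c^m\,\widehat e_m(z).$$ They are $\Lambda_\tau$-periodic (non-holomorphic in general), $\widehat e_0=1$, and for $m\ge1$ they are smooth away from $\Lambda_\tau$ with a simple holomorphic pole there (locally (smooth function)$/z$). **Operations.** A function is smooth with holomorphic poles along a divisor $D$ if locally it is $g/h^k$ with $g$ smooth, $h$ a local holomorphic equation of $D$, $k\geq 0$. For such $f$ on $E$ with finite polar set $D$: the holomorphic residue is $\mathrm{res}_\partial(f\,dz)=\sum_{p\in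 D}\frac1{2\pi\mathbf{i}}\lim_{\varepsilon\to0}\oint_{|z-p|=\varepsilon}f\,dz$, and the regularized integral is $\mathrm{reg}\!\int_E f\,\mathrm{vol}=\lim_{\varepsilon\to0}\int_{E\setminus\bigcup_{p\in D}\{|z-p|<\varepsilon\}}f\,\mathrm{vol}$. On $E^n$ both are iterated: apply the operation successively in $z_1,z_2,\dots,z_n$, with the remaining variables generic at each stage. (The iterated regularized integral is independent of the order; the iterated residue in general is not.) *)

theory Defs
  imports "HOL-Complex_Analysis.Complex_Analysis"
begin

definition lattice :: "complex \<Rightarrow> complex set" where
  "lattice \<tau> = {of_int a + of_int b * \<tau> |a b. True}"

(* Half-open, so it contains exactly one representative of each point of E. *)
definition fundamental_cell :: "complex \<Rightarrow> complex set" where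
  "fundamental_cell \<tau> = {of_real a + of_real b * \<tau> |a b. a \<in> {0..<1} \<and> b \<in> {0..<1}}"

definition is_theta :: "complex \<Rightarrow> (complex \<Rightarrow> complex) \<Rightarrow> bool" where
  "is_theta \<tau> \<theta> \<longleftrightarrow>
     \<theta> holomorphic_on UNIV \<and>
     (\<forall>z. \<theta> (- z) = - \<theta> z) \<and>
     (\<forall>z. \<theta> z = 0 \<longleftrightarrow> z \<in> lattice \<tau>) \<and>
     (\<forall>z\<in>lattice \<tau>. deriv \<theta> z \<noteq> 0) \<and>
     deriv \<theta> 0 = 1 \<and>
     (\<forall>z. \<theta> (z + 1) = - \<theta> z) \<and>
     (\<forall>z. \<theta> (z + \<tau>) = - exp (- pi * \<i> * \<tau>) * exp (- 2 * pi * \<i> * z) * \<theta> z)"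

definition A_fun :: "complex \<Rightarrow> complex \<Rightarrow> complex" where
  "A_fun \<tau> z = 2 * pi * \<i> * ((cnj z - z) / (cnj \<tau> - \<tau>))"

(* The shift by one accounts for the factor 1/c in front of the sum over c^m.
   For z in the lattice the value is the junk value 0. *)
definition ehat :: "complex \<Rightarrow> (complex \<Rightarrow> complex) \<Rightarrow> nat \<Rightarrow> complex \<Rightarrow> complex" where
  "ehat \<tau> \<theta> m z =
     fls_nth (laurent_expansion (\<lambda>c. exp (c * A_fun \<tau> z) * (\<theta> (z + c) / (\<theta> z * \<theta> c))) 0)
       (int m - 1)"

(* Real smoothness: derivatives are real-linear Frechet derivatives. *)
primrec Ck_on :: "nat \<Rightarrow> complex set \<Rightarrow> (complex \<Rightarrow> complex) \<Rightarrow> bool" where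
  "Ck_on 0 U f \<longleftrightarrow> continuous_on U f"
| "Ck_on (Suc k) U f \<longleftrightarrow>
     (\<forall>z\<in>U. f differentiable (at z)) \<and> (\<forall>v. Ck_on k U (\<lambda>z. frechet_derivative f (at z) v))"

definition smooth_on :: "complex set \<Rightarrow> (complex \<Rightarrow> complex) \<Rightarrow> bool" where
  "smooth_on U f \<longleftrightarrow> (\<forall>k. Ck_on k U f)"

(* Finite subsets of E are encoded by their lattice-invariant preimages in the complex plane. *)
definition finite_on_torus :: "complex \<Rightarrow> complex set \<Rightarrow> bool" where
  "finite_on_torus \<tau> D \<longleftrightarrow>
     (\<forall>z. \<forall>l\<in>lattice \<tau>. z \<in> D \<longleftrightarrow> z + l \<in> D) \<and> finite (D \<inter> fundamental_cell \<tau>)"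

(* f represents a function on E minus D; its values on D are irrelevant. *)
definition smooth_holo_poles :: "complex \<Rightarrow> complex set \<Rightarrow> (complex \<Rightarrow> complex) \<Rightarrow> bool" where
  "smooth_holo_poles \<tau> D f \<longleftrightarrow>
     finite_on_torus \<tau> D \<and>
     (\<forall>z. \<forall>l\<in>lattice \<tau>. z \<notin> D \<longrightarrow> f (z + l) = f z) \<and>
     (\<forall>p. \<exists>U g h k. open U \<and> p \<in> U \<and> smooth_on U g \<and>
        h holomorphic_on U \<and> (\<forall>z\<in>U. h z = 0 \<longleftrightarrow> z \<in> D) \<and> (\<forall>z\<in>U \<inter> D. deriv h z \<noteq> 0) \<and>
        (\<forall>z\<in>U - D. f z = g z / h z ^ (k::nat)))"

(* D may be any finite set containing the actual polar set: points of D near which f extends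
   smoothly contribute nothing to the limits below, so the value does not depend on D. *)
definition has_holo_residue ::
  "complex \<Rightarrow> complex set \<Rightarrow> (complex \<Rightarrow> complex) \<Rightarrow> complex \<Rightarrow> bool" where
  "has_holo_residue \<tau> D f r \<longleftrightarrow>
     smooth_holo_poles \<tau> D f \<and>
     (\<exists>L. (\<forall>p\<in>D \<inter> fundamental_cell \<tau>.
             ((\<lambda>\<epsilon>. contour_integral (circlepath p \<epsilon>) f) \<longlongrightarrow> L p) (at_right 0)) \<and>
          r = (\<Sum>p\<in>D \<inter> fundamental_cell \<tau>. 1 / (2 * pi * \<i>) * L p))"

(* vol = (i / (2 Im tau)) dz dzbar is Lebesgue measure dx dy divided by Im tau. *)
definition has_reg_integral ::
  "complex \<Rightarrow> complex set \<Rightarrow> (complex \<Rightarrow> complex) \<Rightarrow> complex \<Rightarrow> bool" where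
  "has_reg_integral \<tau> D f v \<longleftrightarrow>
     smooth_holo_poles \<tau> D f \<and>
     ((\<lambda>\<epsilon>. set_lebesgue_integral lborel (fundamental_cell \<tau> - (\<Union>p\<in>D. ball p \<epsilon>)) f
            / of_real (Im \<tau>)) \<longlongrightarrow> v) (at_right 0)"

(* "has_iterated R k F z v": applying the operation R to F successively in the variables
   z 1, z 2, ..., z k (z 1 first, hence innermost), with z (k + 1), z (k + 2), ... held fixed,
   yields v.  At each stage the inner result G w need only be defined for w outside the finite
   set D that R disregards; this is the genericity of the remaining variables.
   The values of z at 1, ..., k are irrelevant. *)
primrec has_iterated ::
  "(complex set \<Rightarrow> (complex \<Rightarrow> complex) \<Rightarrow> complex \<Rightarrow> bool) \<Rightarrow> nat \<Rightarrow>
   ((nat \<Rightarrow> complex) \<Rightarrow> complex) \<Rightarrow> (nat \<Rightarrow> complex) \<Rightarrow> complex \<Rightarrow> bool" where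
  "has_iterated R 0 F z v \<longleftrightarrow> v = F z"
| "has_iterated R (Suc k) F z v \<longleftrightarrow>
     (\<exists>D G. R D G v \<and> (\<forall>w. w \<notin> D \<longrightarrow> has_iterated R k F (z(Suc k := w)) (G w)))"

(* c k stands for the constant with index pair (k, k + 1); indices are cyclic in {1..n}. *)
definition s_var :: "nat \<Rightarrow> (nat \<Rightarrow> complex) \<Rightarrow> (nat \<Rightarrow> complex) \<Rightarrow> nat \<Rightarrow> complex" where
  "s_var n c z k = c k + z k - z (if k = n then 1 else k + 1)"

definition xi_chain ::
  "complex \<Rightarrow> (complex \<Rightarrow> complex) \<Rightarrow> nat \<Rightarrow> (nat \<Rightarrow> nat) \<Rightarrow> (nat \<Rightarrow> complex) \<Rightarrow> complex \<Rightarrow>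
   (nat \<Rightarrow> complex) \<Rightarrow> complex" where
  "xi_chain \<tau> \<theta> n m c z0 z =
     (\<Prod>k=1..n-1. ehat \<tau> \<theta> (m k) (s_var n c z k)) * ehat \<tau> \<theta> (m n) (z n - z0)"

definition xi_loop ::
  "complex \<Rightarrow> (complex \<Rightarrow> complex) \<Rightarrow> nat \<Rightarrow> (nat \<Rightarrow> nat) \<Rightarrow> (nat \<Rightarrow> complex) \<Rightarrow>
   (nat \<Rightarrow> complex) \<Rightarrow> complex" where
  "xi_loop \<tau> \<theta> n m c z = (\<Prod>k=1..n. ehat \<tau> \<theta> (m k) (s_var n c z k))"

end

(*
  Off the lattice, e_m = N_m / theta with N_m smooth on the plane, and the operator
  d = (derivative along tau) - tau * (derivative along 1), a multiple of d-bar, satisfies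
  d e_m = 2 pi i e_(m-1).  Hence e_a(z - p) e_b(q - z) has the telescoping d-primitive
  sum_(i<=b) e_(a+1+i)(z - p) e_(b-i)(q - z) divided by 2 pi i.  Subtracting multiples of
  e_1(z - p) and e_1(q - z) cancels its residues; the first derivatives of the difference are
  O(1/|z - pole|), hence integrable over a period cell, and integrate to 0 by Fubini and the
  fundamental theorem of calculus along the two periods.  As d e_1 is constant, this evaluates
  the integral of e_a(z - p) e_b(q - z) as a combination of values e_k(q - p) without Stokes'
  theorem on a punctured torus.  Integrating z_1, z_2, ... in turn then replaces the two factors
  containing the current variable by a single factor of the same kind.
*)
theory Submission
  imports Defs
begin

section \<open>Smoothness and the d-bar operator\<close>

text \<open>Every one-variable step is brought to the shape
  \<open>K * (E a (z - p) * E b (q - z))\<close>. Off the lattice \<open>E 0\<close> is 1, so a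
  chain step, with a single factor, and the last loop step, with none, fit after padding by
  \<open>E 0\<close>; a missing second pole is put half a period away. The obstacle is
  non-holomorphy: even with both residues cancelled, the primitive is in general only bounded near
  its poles, not differentiable there. Working with numerators over the common denominator
  \<open>\<theta> (z - p) * \<theta> (q - z)\<close> turns cancellation of residues into vanishing
  of a smooth numerator at simple zeros, and this gives the bound on the derivatives. The resulting
  integral is 1 for \<open>a = b = 0\<close>, \<open>- E (a + b) (q - p)\<close> when both indices
  are positive, and 0 otherwise. Hence a loop survives only if all indices vanish or all are
  positive, with one sign for each of the first \<open>n - 1\<close> integrations in the second
  case. The loop residue is 0 because nothing depends on the last variable any more.\<close>

inductive_set real_analytic_algebra :: "(complex \<Rightarrow> complex) set" where
  holomorphic: "f holomorphic_on UNIV \<Longrightarrow> f \<in> real_analytic_algebra"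
| cnj: "cnj \<in> real_analytic_algebra"
| add: "f \<in> real_analytic_algebra \<Longrightarrow> g \<in> real_analytic_algebra \<Longrightarrow>
    (\<lambda>z. f z + g z) \<in> real_analytic_algebra"
| mult: "f \<in> real_analytic_algebra \<Longrightarrow> g \<in> real_analytic_algebra \<Longrightarrow>
    (\<lambda>z. f z * g z) \<in> real_analytic_algebra"

lemma real_analytic_algebra_const [intro, simp]: "(\<lambda>_. a) \<in> real_analytic_algebra"
  by (rule real_analytic_algebra.holomorphic) auto

lemma real_analytic_algebra_diff:
  assumes "f \<in> real_analytic_algebra" "g \<in> real_analytic_algebra"
  shows "(\<lambda>z. f z - g z) \<in> real_analytic_algebra"
  using real_analytic_algebra.add[OF assms(1) real_analytic_algebra.mult[OF
    real_analytic_algebra_const[of "-1"] assms(2)]] by simp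

lemma real_analytic_algebra_power:
  assumes "f \<in> real_analytic_algebra"
  shows "(\<lambda>z. f z ^ n) \<in> real_analytic_algebra"
  by (induction n) (auto intro: real_analytic_algebra.mult assms)

lemma real_analytic_algebra_sum:
  assumes "\<And>i. i \<in> I \<Longrightarrow> f i \<in> real_analytic_algebra"
  shows "(\<lambda>z. \<Sum>i\<in>I. f i z) \<in> real_analytic_algebra"
  using assms
  by (induction I rule: infinite_finite_induct) (auto intro: real_analytic_algebra.add)

lemma real_analytic_algebra_affine:
  assumes "f \<in> real_analytic_algebra"
  shows "(\<lambda>z. f (a * z + b)) \<in> real_analytic_algebra"
  using assms
proof induction
  case (holomorphic f)
  have "(f \<circ> (\<lambda>z. a * z + b)) holomorphic_on UNIV"
    by (rule holomorphic_on_compose_gen[of _ _ _ UNIV]) (auto intro!: holomorphic_intros holomorphic)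
  then show ?case by (auto simp: o_def intro: real_analytic_algebra.holomorphic)
next
  case cnj
  show ?case
    by (simp, intro real_analytic_algebra.add real_analytic_algebra.mult real_analytic_algebra.cnj) auto
qed (auto intro: real_analytic_algebra.intros)

text \<open>This closure property is what the class is made for: a directional derivative of a sum
  of products of entire functions and \<open>cnj\<close> is again of that form, so differentiability
  of every order follows by a single induction.\<close>

lemma real_analytic_algebra_has_derivative:
  assumes "f \<in> real_analytic_algebra"
  obtains f' where "\<And>z. (f has_derivative f' z) (at z)"
    "\<And>v. (\<lambda>z. f' z v) \<in> real_analytic_algebra"
proof -
  have "\<exists>f'. (\<forall>z. (f has_derivative f' z) (at z)) \<and> (\<forall>v. (\<lambda>z. f' z v) \<in> real_analytic_algebra)"
    using assms
  proof induction
    case (holomorphic f)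
    have "(f has_derivative (\<lambda>v. deriv f z * v)) (at z)" for z
      using holomorphic by (metis UNIV_I has_field_derivative_def holomorphic_derivI open_UNIV)
    moreover have "(\<lambda>z. deriv f z * v) \<in> real_analytic_algebra" for v
      by (intro real_analytic_algebra.holomorphic holomorphic_intros holomorphic) auto
    ultimately show ?case by (intro exI[of _ "\<lambda>z v. deriv f z * v"]) auto
  next
    case cnj
    show ?case
      by (intro exI[of _ "\<lambda>z v. cnj v"]) (auto intro: bounded_linear_imp_has_derivative bounded_linear_cnj)
  next
    case (add f g)
    then obtain f' g' where *: "\<forall>z. (f has_derivative f' z) (at z)" "\<forall>z. (g has_derivative g' z) (at z)"
      "\<forall>v. (\<lambda>z. f' z v) \<in> real_analytic_algebra" "\<forall>v. (\<lambda>z. g' z v) \<in> real_analytic_algebra"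
      by auto
    then show ?case
      by (intro exI[of _ "\<lambda>z v. f' z v + g' z v"]) (auto intro!: derivative_intros real_analytic_algebra.add)
  next
    case (mult f g)
    then obtain f' g' where *: "\<forall>z. (f has_derivative f' z) (at z)" "\<forall>z. (g has_derivative g' z) (at z)"
      "\<forall>v. (\<lambda>z. f' z v) \<in> real_analytic_algebra" "\<forall>v. (\<lambda>z. g' z v) \<in> real_analytic_algebra"
      by auto
    with mult.hyps show ?case
      by (intro exI[of _ "\<lambda>z v. f z * g' z v + f' z v * g z"])
        (auto intro!: has_derivative_mult real_analytic_algebra.add real_analytic_algebra.mult)
  qed
  then show ?thesis using that by blast
qed

lemma real_analytic_algebra_continuous:
  assumes "f \<in> real_analytic_algebra"
  shows "continuous_on S f"
  using assms
  by (metis real_analytic_algebra_has_derivative has_derivative_at_withinI has_derivative_continuous_on)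

lemma smooth_on_real_analytic_algebra:
  assumes "f \<in> real_analytic_algebra"
  shows "smooth_on UNIV f"
proof -
  have "Ck_on k UNIV f" for k
    using assms
  proof (induction k arbitrary: f)
    case 0
    then show ?case by (simp add: real_analytic_algebra_continuous)
  next
    case (Suc k)
    obtain f' where f': "\<And>z. (f has_derivative f' z) (at z)"
      "\<And>v. (\<lambda>z. f' z v) \<in> real_analytic_algebra"
      using real_analytic_algebra_has_derivative[OF Suc.prems] by blast
    have "frechet_derivative f (at z) = f' z" for z
      using f'(1) frechet_derivative_at by metis
    with f' Suc.IH show ?case by (auto simp: differentiable_def)
  qed
  then show ?thesis by (simp add: smooth_on_def)
qed

(* With f' the real derivative, f' \<tau> - \<tau> * f' 1 is cnj \<tau> - \<tau> times the
   Wirtinger derivative of f with respect to cnj z. *)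
definition has_dbar :: "complex \<Rightarrow> (complex \<Rightarrow> complex) \<Rightarrow> complex \<Rightarrow> complex \<Rightarrow> bool" where
  "has_dbar \<tau> f d z \<longleftrightarrow> (\<exists>f'. (f has_derivative f') (at z) \<and> f' \<tau> - \<tau> * f' 1 = d)"

text \<open>A complex-linear derivative sends \<tau> to \<tau> times its value at 1.\<close>

lemma has_dbar_holomorphic:
  assumes "f holomorphic_on UNIV"
  shows "has_dbar \<tau> f 0 z"
proof -
  have "(f has_derivative (\<lambda>v. deriv f z * v)) (at z)"
    using assms by (metis UNIV_I has_field_derivative_def holomorphic_derivI open_UNIV)
  then show ?thesis by (force simp: has_dbar_def)
qed

lemma has_dbar_const: "has_dbar \<tau> (\<lambda>_. a) 0 z"
  by (rule has_dbar_holomorphic) auto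

lemma has_dbar_add:
  assumes "has_dbar \<tau> f a z" "has_dbar \<tau> g b z"
  shows "has_dbar \<tau> (\<lambda>z. f z + g z) (a + b) z"
proof -
  obtain f' g' where "(f has_derivative f') (at z)" "(g has_derivative g') (at z)"
    "f' \<tau> - \<tau> * f' 1 = a" "g' \<tau> - \<tau> * g' 1 = b"
    using assms by (auto simp: has_dbar_def)
  then show ?thesis unfolding has_dbar_def
    by (intro exI[of _ "\<lambda>v. f' v + g' v"]) (auto intro!: derivative_intros simp: algebra_simps)
qed

lemma has_dbar_mult:
  assumes "has_dbar \<tau> f a z" "has_dbar \<tau> g b z"
  shows "has_dbar \<tau> (\<lambda>z. f z * g z) (a * g z + f z * b) z"
proof -
  obtain f' g' where "(f has_derivative f') (at z)" "(g has_derivative g') (at z)"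
    "f' \<tau> - \<tau> * f' 1 = a" "g' \<tau> - \<tau> * g' 1 = b"
    using assms by (auto simp: has_dbar_def)
  then show ?thesis unfolding has_dbar_def
    by (intro exI[of _ "\<lambda>v. f z * g' v + f' v * g z"])
      (auto intro!: has_derivative_mult simp: algebra_simps)
qed

lemma has_dbar_cmult:
  assumes "has_dbar \<tau> f a z"
  shows "has_dbar \<tau> (\<lambda>z. k * f z) (k * a) z"
  using has_dbar_mult[OF has_dbar_const assms] by simp

lemma has_dbar_sum:
  assumes "\<And>i. i \<in> I \<Longrightarrow> has_dbar \<tau> (f i) (d i) z"
  shows "has_dbar \<tau> (\<lambda>z. \<Sum>i\<in>I. f i z) (\<Sum>i\<in>I. d i) z"
  using assms
  by (induction I rule: infinite_finite_induct) (auto intro: has_dbar_const has_dbar_add)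

lemma has_dbar_power:
  assumes "has_dbar \<tau> f a z"
  shows "has_dbar \<tau> (\<lambda>z. f z ^ n) (of_nat n * f z ^ (n - 1) * a) z"
proof (induction n)
  case 0
  then show ?case by (simp add: has_dbar_const)
next
  case (Suc n)
  have "a * f z ^ n + f z * (of_nat n * f z ^ (n - 1) * a) = of_nat (Suc n) * f z ^ (Suc n - 1) * a"
    by (cases n) (simp_all add: algebra_simps)
  with has_dbar_mult[OF assms Suc] show ?case by simp
qed

text \<open>The scale \<open>a\<close> is real because the derivative of \<open>f\<close> is only
  real-linear. The values 1 and -1 cover the arguments \<open>z - p\<close> and
  \<open>q - z\<close>.\<close>

lemma has_dbar_affine:
  assumes "has_dbar \<tau> f d (of_real a * z + b)"
  shows "has_dbar \<tau> (\<lambda>z. f (of_real a * z + b)) (of_real a * d) z"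
proof -
  obtain f' where f': "(f has_derivative f') (at (of_real a * z + b))" and d: "f' \<tau> - \<tau> * f' 1 = d"
    using assms by (auto simp: has_dbar_def)
  have "((\<lambda>z. of_real a * z + b) has_derivative (\<lambda>v. of_real a * v)) (at z)"
    by (auto intro!: derivative_eq_intros)
  from has_derivative_compose[OF this f']
  have "((\<lambda>z. f (of_real a * z + b)) has_derivative (\<lambda>v. f' (of_real a * v))) (at z)" .
  moreover have "f' (of_real a * v) = of_real a * f' v" for v
    using linear_cmul[OF has_derivative_linear[OF f'], of a v] by (simp add: scaleR_conv_of_real)
  ultimately show ?thesis unfolding has_dbar_def d[symmetric]
    by (intro exI[of _ "\<lambda>v. of_real a * f' v"]) (simp add: right_diff_distrib mult.left_commute)
qed

section \<open>The period lattice and functions periodic under it\<close>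

lemma lattice_add: "x \<in> lattice \<tau> \<Longrightarrow> y \<in> lattice \<tau> \<Longrightarrow> x + y \<in> lattice \<tau>"
proof -
  assume "x \<in> lattice \<tau>" "y \<in> lattice \<tau>"
  then obtain a b c d where "x = of_int a + of_int b * \<tau>" "y = of_int c + of_int d * \<tau>"
    by (auto simp: lattice_def)
  then have "x + y = of_int (a + c) + of_int (b + d) * \<tau>" by (simp add: algebra_simps)
  then show ?thesis unfolding lattice_def by blast
qed

lemma lattice_minus: "x \<in> lattice \<tau> \<Longrightarrow> - x \<in> lattice \<tau>"
proof -
  assume "x \<in> lattice \<tau>"
  then obtain a b where "x = of_int a + of_int b * \<tau>" by (auto simp: lattice_def)
  then have "- x = of_int (- a) + of_int (- b) * \<tau>" by (simp add: algebra_simps)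
  then show ?thesis unfolding lattice_def by blast
qed

lemma lattice_minus_iff [simp]: "- x \<in> lattice \<tau> \<longleftrightarrow> x \<in> lattice \<tau>"
  using lattice_minus[of x] lattice_minus[of "- x"] by auto

lemma lattice_diff: "x \<in> lattice \<tau> \<Longrightarrow> y \<in> lattice \<tau> \<Longrightarrow> x - y \<in> lattice \<tau>"
  using lattice_add[of x \<tau> "- y"] by simp

lemma lattice_0 [simp]: "0 \<in> lattice \<tau>"
  unfolding lattice_def by (auto intro: exI[of _ 0])

lemma lattice_1 [simp]: "1 \<in> lattice \<tau>"
  unfolding lattice_def by (auto intro: exI[of _ 1] exI[of _ 0])

lemma lattice_tau [simp]: "\<tau> \<in> lattice \<tau>"
  unfolding lattice_def by (auto intro: exI[of _ 1] exI[of _ 0])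

lemma lattice_add_iff [simp]:
  assumes "l \<in> lattice \<tau>"
  shows "x + l \<in> lattice \<tau> \<longleftrightarrow> x \<in> lattice \<tau>"
  using lattice_add[OF _ assms, of x] lattice_diff[OF _ assms, of "x + l"] by auto

lemma lattice_periodic:
  assumes "\<And>z. f (z + 1) = f z" "\<And>z. f (z + \<tau>) = f z" and l: "l \<in> lattice \<tau>"
  shows "f (z + l) = f z"
proof -
  have nat: "f (z + of_nat n * w) = f z" if "\<And>z. f (z + w) = f z" for n w z
    proof (induction n)
    case (Suc n)
    have "f (z + of_nat (Suc n) * w) = f ((z + of_nat n * w) + w)" by (simp add: algebra_simps)
    with Suc that show ?case by metis
  qed simp
  have int: "f (z + of_int n * w) = f z" if "\<And>z. f (z + w) = f z" for n w z
  proof (cases "n \<ge> 0")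
    case True
    then show ?thesis using nat[OF that, of z "nat n"] by simp
  next
    case False
    \<comment> \<open>For negative \<open>n\<close> the natural-number case is applied at the
      translated point, from which \<open>- n\<close> periods lead back to \<open>z\<close>.\<close>
    then show ?thesis using nat[OF that, of "z + of_int n * w" "nat (- n)"] by simp
  qed
  obtain a b where "l = of_int a + of_int b * \<tau>" using l by (auto simp: lattice_def)
  then have "f (z + l) = f ((z + of_int a * 1) + of_int b * \<tau>)" by (simp add: add.assoc)
  also have "\<dots> = f z" using int[OF assms(1)] int[OF assms(2)] by metis
  finally show ?thesis .
qed

section \<open>The functions \<open>ehat\<close> as quotients\<close>

locale kronecker_eisenstein =
  fixes \<tau> :: complex and \<theta> :: "complex \<Rightarrow> complex"
  assumes Im_tau: "Im \<tau> > 0" and is_theta: "is_theta \<tau> \<theta>"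
begin

abbreviation "\<Lambda> \<equiv> lattice \<tau>"
abbreviation "A \<equiv> A_fun \<tau>"
abbreviation "E \<equiv> ehat \<tau> \<theta>"

lemma theta_holomorphic: "\<theta> holomorphic_on S"
  and theta_eq_0_iff: "\<theta> z = 0 \<longleftrightarrow> z \<in> \<Lambda>"
  and deriv_theta_nonzero: "z \<in> \<Lambda> \<Longrightarrow> deriv \<theta> z \<noteq> 0"
  and deriv_theta_0: "deriv \<theta> 0 = 1"
  and theta_add_1: "\<theta> (z + 1) = - \<theta> z"
  and theta_add_tau: "\<theta> (z + \<tau>) = - exp (- pi * \<i> * \<tau>) * exp (- 2 * pi * \<i> * z) * \<theta> z"
  using is_theta by (auto simp: is_theta_def intro: holomorphic_on_subset)

lemma cnj_tau_neq: "cnj \<tau> - \<tau> \<noteq> 0"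
  using Im_tau by (auto simp: complex_eq_iff)

lemma A_add_1: "A (z + 1) = A z"
  by (simp add: A_fun_def)

text \<open>The jump by \<open>2 * pi * \<i>\<close> makes \<open>exp (c * A z)\<close> gain the
  factor \<open>exp (2 * pi * \<i> * c)\<close>, which cancels the factor of automorphy of
  \<open>\<theta> (z + c) / \<theta> z\<close>.\<close>

lemma A_add_tau: "A (z + \<tau>) = A z + 2 * pi * \<i>"
proof -
  have "cnj (z + \<tau>) - (z + \<tau>) = (cnj z - z) + (cnj \<tau> - \<tau>)" by simp
  then have "(cnj (z + \<tau>) - (z + \<tau>)) / (cnj \<tau> - \<tau>) = (cnj z - z) / (cnj \<tau> - \<tau>) + 1"
    using cnj_tau_neq by (simp only: add_divide_distrib) simp
  then show ?thesis unfolding A_fun_def by (simp only: distrib_left mult_1_right)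
qed

text \<open>\<open>A\<close> is real-linear, hence its own derivative, with
  \<open>A \<tau> = 2 * pi * \<i>\<close> and \<open>A 1 = 0\<close>.\<close>

lemma has_dbar_A: "has_dbar \<tau> A (2 * pi * \<i>) z"
proof -
  have "bounded_linear (\<lambda>z. (2 * pi * \<i> / (cnj \<tau> - \<tau>)) * (cnj z - z))"
    by (intro bounded_linear_const_mult bounded_linear_sub bounded_linear_cnj bounded_linear_ident)
  then have "(A has_derivative A) (at z)"
    by (intro bounded_linear_imp_has_derivative) (simp add: A_fun_def[abs_def])
  moreover have "A \<tau> - \<tau> * A 1 = 2 * pi * \<i>" using cnj_tau_neq by (simp add: A_fun_def)
  ultimately show ?thesis unfolding has_dbar_def by blast
qed

lemma A_algebra: "A \<in> real_analytic_algebra"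
proof -
  have "(\<lambda>z. (2 * pi * \<i> / (cnj \<tau> - \<tau>)) * (cnj z - z)) \<in> real_analytic_algebra"
    by (intro real_analytic_algebra.mult real_analytic_algebra_diff real_analytic_algebra.cnj
        real_analytic_algebra_const real_analytic_algebra.holomorphic) auto
  then show ?thesis by (simp add: A_fun_def[abs_def])
qed

text \<open>The generating functions at \<open>z\<close> and at its translate by a period coincide
  as functions of \<open>c\<close>, hence so do all their Laurent coefficients. At lattice points
  both are identically 0 by division by zero.\<close>

lemma E_periodic:
  assumes "l \<in> \<Lambda>"
  shows "E m (z + l) = E m z"
proof (rule lattice_periodic[OF _ _ assms])
  fix z
  have "\<theta> (z + 1 + c) = - \<theta> (z + c)" for c
    using theta_add_1[of "z + c"] by (simp add: add_ac)
  then show "E m (z + 1) = E m z"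
    by (simp add: ehat_def A_add_1 theta_add_1)
next
  fix z
  define K where "K = - exp (- pi * \<i> * \<tau>) * exp (- 2 * pi * \<i> * z)"
  have "K \<noteq> 0" by (simp add: K_def)
  have K: "\<theta> (z + \<tau>) = K * \<theta> z"
    by (simp add: K_def theta_add_tau)
  have K': "\<theta> (z + \<tau> + c) = K * (exp (- 2 * pi * \<i> * c) * \<theta> (z + c))" for c
  proof -
    have "\<theta> (z + \<tau> + c) = \<theta> ((z + c) + \<tau>)" by (simp add: add_ac)
    then show ?thesis
      unfolding theta_add_tau distrib_left exp_add K_def by (simp only: mult_ac)
  qed
  have "exp (c * A (z + \<tau>)) * (\<theta> (z + \<tau> + c) / (\<theta> (z + \<tau>) * \<theta> c))
      = exp (c * A z) * (\<theta> (z + c) / (\<theta> z * \<theta> c))" for c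
  proof -
    have "exp (c * A (z + \<tau>)) * exp (- 2 * pi * \<i> * c) = exp (c * A z)"
      unfolding A_add_tau mult_exp_exp by (simp add: algebra_simps)
    then show ?thesis using \<open>K \<noteq> 0\<close> unfolding K K'
      by (metis (no_types, lifting) mult.assoc mult_divide_mult_cancel_left times_divide_eq_right)
  qed
  then show "E m (z + \<tau>) = E m z"
    by (simp add: ehat_def)
qed

section \<open>Numerators over \<theta>\<close>

definition theta_series :: "complex fps" where
  "theta_series = fps_expansion \<theta> 0"

text \<open>The coefficient of \<open>c ^ m\<close> in
  \<open>c * \<theta> (z + c) / \<theta> c\<close>. The shifted series is that of
  \<open>\<theta> c / c\<close>, whose constant term 1 makes it invertible.\<close>

definition theta_coeff :: "nat \<Rightarrow> complex \<Rightarrow> complex" where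
  "theta_coeff m z = (fps_expansion \<theta> z * inverse (fps_shift 1 theta_series)) $ m"

text \<open>The coefficient of \<open>c ^ m\<close> in
  \<open>exp (c * A z) * c * \<theta> (z + c) / \<theta> c\<close>, as a Cauchy product. It stays
  meaningful at lattice points, where \<open>E m\<close> has only a default value.\<close>

definition N :: "nat \<Rightarrow> complex \<Rightarrow> complex" where
  "N m z = (\<Sum>i\<le>m. A z ^ i / fact i * theta_coeff (m - i) z)"

lemma theta_series_nth: "theta_series $ 0 = 0" "theta_series $ 1 = 1"
  using theta_eq_0_iff[of 0] by (simp_all add: theta_series_def fps_expansion_def deriv_theta_0)

lemma theta_series_factor: "theta_series = fps_X * fps_shift 1 theta_series"
  by (rule fps_ext) (simp add: theta_series_nth)

lemma theta_coeff_holomorphic: "theta_coeff m holomorphic_on S"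
proof -
  have "theta_coeff m holomorphic_on UNIV"
    unfolding theta_coeff_def[abs_def] fps_mult_nth fps_expansion_def fps_nth_Abs_fps
    by (intro holomorphic_intros holomorphic_higher_deriv theta_holomorphic) auto
  then show ?thesis using holomorphic_on_subset by blast
qed

lemma theta_coeff_0: "theta_coeff 0 z = \<theta> z"
  using theta_series_nth by (simp add: theta_coeff_def fps_expansion_def)

text \<open>At \<open>z = 0\<close> the generating series
  \<open>c * \<theta> (z + c) / \<theta> c\<close> collapses to \<open>c\<close>. This is why only
  the function with index 1 has a pole.\<close>

lemma theta_coeff_at_0: "theta_coeff m 0 = of_bool (m = 1)"
proof -
  have "theta_series * inverse (fps_shift 1 theta_series) = fps_X"
    using theta_series_nth inverse_mult_eq_1'[of "fps_shift 1 theta_series"]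
    by (subst theta_series_factor) (simp add: mult.assoc)
  then show ?thesis by (simp add: theta_coeff_def flip: theta_series_def)
qed

lemma N_0: "N 0 z = \<theta> z"
  by (simp add: N_def theta_coeff_0)

lemma N_at_0: "N m 0 = of_bool (m = 1)"
proof -
  have "A 0 ^ i / fact i * theta_coeff (m - i) 0 = (if i = 0 then theta_coeff m 0 else 0)" for i
    by (simp add: A_fun_def)
  then show ?thesis by (simp add: N_def theta_coeff_at_0)
qed

lemma N_algebra: "N m \<in> real_analytic_algebra"
  unfolding N_def[abs_def] divide_inverse
  by (intro real_analytic_algebra_sum real_analytic_algebra.mult real_analytic_algebra_power A_algebra
      real_analytic_algebra_const real_analytic_algebra.holomorphic[OF theta_coeff_holomorphic])

text \<open>The coefficients \<open>theta_coeff\<close> are holomorphic, so only the powers of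
  \<open>A\<close> contribute: the operator multiplies the generating series by
  \<open>2 * pi * \<i> * c\<close>, which lowers the index by one.\<close>

lemma has_dbar_N:
  "has_dbar \<tau> (N m) (if m = 0 then 0 else 2 * pi * \<i> * N (m - 1) z) z"
proof -
  have "has_dbar \<tau> (N m)
    (\<Sum>i\<le>m. (1 / fact i * (of_nat i * A z ^ (i - 1) * (2 * pi * \<i>))) * theta_coeff (m - i) z
      + (1 / fact i * A z ^ i) * 0) z" (is "has_dbar _ _ ?d _")
  proof -
    have "N m = (\<lambda>z. \<Sum>i\<le>m. (1 / fact i * A z ^ i) * theta_coeff (m - i) z)"
      by (simp add: N_def fun_eq_iff)
    then show ?thesis
      by (simp only:) (intro has_dbar_sum has_dbar_mult has_dbar_cmult has_dbar_power has_dbar_A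
        has_dbar_holomorphic[OF theta_coeff_holomorphic])
  qed
  moreover have "?d = (if m = 0 then 0 else 2 * pi * \<i> * N (m - 1) z)"
  proof (cases m)
    case (Suc k)
    have "?d = (\<Sum>i\<le>k. (1 / fact (Suc i) * (of_nat (Suc i) * A z ^ i * (2 * pi * \<i>))) * theta_coeff (k - i) z)"
      unfolding Suc sum.atMost_Suc_shift by simp
    also have "\<dots> = 2 * pi * \<i> * N k z"
      unfolding N_def sum_distrib_left by (intro sum.cong) (auto simp del: of_nat_Suc)
    finally show ?thesis by (simp add: Suc)
  qed simp
  ultimately show ?thesis by simp
qed

text \<open>The simple zero of \<theta> at 0 produces the factor \<open>1 / c\<close> for which the
  index \<open>int m - 1\<close> in \<open>ehat\<close> compensates.\<close>

lemma E_eq_N_over_theta: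
  assumes z: "z \<notin> \<Lambda>"
  shows "E m z = N m z / \<theta> z"
proof -
  define T where "T = fps_shift 1 theta_series"
  have T0: "T $ 0 = 1" using theta_series_nth by (simp add: T_def)
  define P where "P = fps_exp (A z) * fps_expansion \<theta> z"
  have series: "\<theta> has_fps_expansion theta_series"
    unfolding theta_series_def by (rule has_fps_expansion_fps_expansion[of UNIV]) (auto intro: theta_holomorphic)
  have "(\<lambda>c. \<theta> (z + c)) has_fps_expansion fps_expansion \<theta> z"
    by (intro analytic_at_imp_has_fps_expansion) (auto simp: analytic_at intro!: exI[of _ UNIV] theta_holomorphic)
  then have "(\<lambda>c. exp (A z * c) * \<theta> (z + c)) has_fps_expansion P"
    unfolding P_def by (intro fps_expansion_intros)
  then have "(\<lambda>c. (exp (A z * c) * \<theta> (z + c)) * inverse (\<theta> z) / \<theta> c) has_laurent_expansion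
      (fps_to_fls P * fls_const (inverse (\<theta> z)) / fps_to_fls theta_series)"
    by (intro laurent_expansion_intros has_laurent_expansion_fps series)
  then have *: "laurent_expansion (\<lambda>c. exp (c * A z) * (\<theta> (z + c) / (\<theta> z * \<theta> c))) 0
      = fps_to_fls P * fls_const (inverse (\<theta> z)) / fps_to_fls theta_series"
    by (intro laurent_expansion_0_eqI) (simp add: field_simps)
  \<comment> \<open>Splitting off the zero at 0 leaves \<open>T\<close> with constant term 1, so the
    Laurent inverse is \<open>fls_X_inv\<close> times an honest power series.\<close>
  have "fps_to_fls theta_series = fls_X * fps_to_fls T"
    unfolding T_def by (subst theta_series_factor) (simp add: fls_times_fps_to_fls)
  moreover have "fps_to_fls T * fps_to_fls (inverse T) = 1"
    using inverse_mult_eq_1'[of T] T0 by (simp flip: fls_times_fps_to_fls)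
  ultimately have "(fls_X_inv * fps_to_fls (inverse T)) * fps_to_fls theta_series = 1"
    by (simp add: mult_ac) (simp flip: mult.assoc add: fls_X_inv_times_conv_shift fls_X_times_conv_shift)
  then have inv: "inverse (fps_to_fls theta_series) = fls_X_inv * fps_to_fls (inverse T)"
    by (metis inverse_unique mult.commute)
  have "laurent_expansion (\<lambda>c. exp (c * A z) * (\<theta> (z + c) / (\<theta> z * \<theta> c))) 0
      = fls_X_inv * fps_to_fls (fps_const (inverse (\<theta> z)) * (P * inverse T))"
    unfolding * unfolding divide_inverse inv by (simp add: fls_times_fps_to_fls mult_ac)
  \<comment> \<open>\<open>fls_X_inv\<close> lowers exponents by one, so position
    \<open>int m - 1\<close> holds coefficient \<open>m\<close> of the power series.\<close>
  then have "E m z = inverse (\<theta> z) * (P * inverse T) $ m"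
    unfolding ehat_def by (simp add: fls_X_inv_times_conv_shift)
  also have "(P * inverse T) $ m = N m z"
    unfolding P_def N_def theta_coeff_def T_def mult.assoc
    by (subst fps_mult_nth) (simp add: atLeast0AtMost)
  finally show ?thesis by (simp add: field_simps)
qed

lemma E_0: "z \<notin> \<Lambda> \<Longrightarrow> E 0 z = 1"
  using theta_eq_0_iff by (simp add: E_eq_N_over_theta N_0)

end

section \<open>Lebesgue measure in lattice coordinates\<close>

text \<open>It suffices to measure boxes. The slice of a box at fixed \<open>y\<close> is an
  interval of the original width, displaced by \<open>y * Re \<tau>\<close>, and the admissible
  \<open>y\<close> are scaled by \<open>1 / Im \<tau>\<close>. In these coordinates the period cell
  is the unit square and both periods point along axes.\<close>

lemma lborel_complex_eq_skew_coordinates: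
  assumes "Im \<tau> > 0"
  shows "lborel = density (distr (lborel \<Otimes>\<^sub>M lborel) borel (\<lambda>(x, y). of_real x + of_real y * \<tau>))
    (\<lambda>_. ennreal (Im \<tau>))"
    (is "_ = density (distr _ _ ?\<phi>) _")
proof (rule lborel_eqI)
  fix l u :: complex
  assume "\<And>b. b \<in> Basis \<Longrightarrow> l \<bullet> b \<le> u \<bullet> b"
  from this[of 1] this[of \<i>] have le: "Re l \<le> Re u" "Im l \<le> Im u" by (auto simp: complex_Basis_i)
  have [measurable]: "?\<phi> \<in> borel_measurable (lborel \<Otimes>\<^sub>M lborel)" by measurable
  have slice: "(\<lambda>x. (x, y)) -` (?\<phi> -` box l u) =
    (if y \<in> {Im l / Im \<tau><..<Im u / Im \<tau>} then {Re l - y * Re \<tau><..<Re u - y * Re \<tau>} else {})" for y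
    using assms by (auto simp: in_box_complex_iff field_simps)
  have "emeasure (distr (lborel \<Otimes>\<^sub>M lborel) borel ?\<phi>) (box l u)
      = emeasure (lborel \<Otimes>\<^sub>M lborel) (?\<phi> -` box l u)"
    by (subst emeasure_distr) (auto simp: space_pair_measure)
  also have "\<dots> = (\<integral>\<^sup>+y. emeasure lborel ((\<lambda>x. (x, y)) -` (?\<phi> -` box l u)) \<partial>lborel)"
    by (rule lborel_pair.emeasure_pair_measure_alt2)
      (use measurable_sets[of ?\<phi> "lborel \<Otimes>\<^sub>M lborel" borel "box l u"] in \<open>auto simp: space_pair_measure\<close>)
  also have "\<dots> = (\<integral>\<^sup>+y. ennreal (Re u - Re l) * indicator {Im l / Im \<tau><..<Im u / Im \<tau>} y \<partial>lborel)"
    using le by (intro nn_integral_cong) (auto simp: slice)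
  also have "\<dots> = ennreal (Re u - Re l) * ennreal (Im u / Im \<tau> - Im l / Im \<tau>)"
    using le assms by (subst nn_integral_cmult_indicator) (auto simp: divide_right_mono)
  finally have *: "emeasure (distr (lborel \<Otimes>\<^sub>M lborel) borel ?\<phi>) (box l u)
      = ennreal ((Re u - Re l) * ((Im u - Im l) / Im \<tau>))"
    using le assms by (simp add: ennreal_mult diff_divide_distrib divide_right_mono)
  have "emeasure (density (distr (lborel \<Otimes>\<^sub>M lborel) borel ?\<phi>) (\<lambda>_. ennreal (Im \<tau>))) (box l u)
      = ennreal (Im \<tau>) * ennreal ((Re u - Re l) * ((Im u - Im l) / Im \<tau>))"
    by (simp add: emeasure_density_const *)
  also have "\<dots> = ennreal ((Re u - Re l) * (Im u - Im l))"
  proof -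
    have "Im \<tau> * ((Re u - Re l) * ((Im u - Im l) / Im \<tau>)) = (Re u - Re l) * (Im u - Im l)"
      using assms by simp
    then show ?thesis using assms le by (subst ennreal_mult[symmetric]) auto
  qed
  also have "\<dots> = ennreal (\<Prod>b\<in>Basis. (u - l) \<bullet> b)"
    by (simp add: Basis_complex_def)
  finally show "emeasure (density (distr (lborel \<Otimes>\<^sub>M lborel) borel ?\<phi>) (\<lambda>_. ennreal (Im \<tau>))) (box l u)
      = ennreal (\<Prod>b\<in>Basis. (u - l) \<bullet> b)" .
qed simp

lemma
  fixes f :: "complex \<Rightarrow> complex"
  assumes "Im \<tau> > 0" and f: "f \<in> borel_measurable borel"
  shows integrable_skew_coordinates: "integrable lborel f \<longleftrightarrow>
      integrable (lborel \<Otimes>\<^sub>M lborel) (\<lambda>(x, y). f (of_real x + of_real y * \<tau>))"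
    and integral_skew_coordinates: "integral\<^sup>L lborel f =
      Im \<tau> *\<^sub>R integral\<^sup>L (lborel \<Otimes>\<^sub>M lborel) (\<lambda>(x, y). f (of_real x + of_real y * \<tau>))"
proof -
  have [measurable]: "(\<lambda>(x, y). of_real x + of_real y * \<tau>) \<in> borel_measurable (lborel \<Otimes>\<^sub>M lborel)"
    by measurable
  note [measurable] = f
  show "integrable lborel f \<longleftrightarrow>
      integrable (lborel \<Otimes>\<^sub>M lborel) (\<lambda>(x, y). f (of_real x + of_real y * \<tau>))" (is "_ \<longleftrightarrow> integrable ?M ?g")
  proof -
    have "integrable lborel f \<longleftrightarrow> integrable ?M (\<lambda>z. Im \<tau> *\<^sub>R ?g z)"
      using assms by (subst lborel_complex_eq_skew_coordinates[OF assms(1)])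
        (simp add: integrable_density integrable_distr_eq case_prod_unfold)
    moreover have "integrable ?M ?g" if "integrable ?M (\<lambda>z. Im \<tau> *\<^sub>R ?g z)"
      using integrable_scaleR_right[OF that, of "inverse (Im \<tau>)"] assms(1) by simp
    ultimately show ?thesis by auto
  qed
  show "integral\<^sup>L lborel f =
      Im \<tau> *\<^sub>R integral\<^sup>L (lborel \<Otimes>\<^sub>M lborel) (\<lambda>(x, y). f (of_real x + of_real y * \<tau>))"
    using assms by (subst lborel_complex_eq_skew_coordinates[OF assms(1)])
      (simp add: integral_density integral_distr case_prod_unfold)
qed

section \<open>Integrability of functions with simple poles\<close>

lemma nn_integral_inverse_sqrt_finite:
  fixes a :: real
  shows "(\<integral>\<^sup>+t. (if t = a then \<infinity> else ennreal (\<bar>t - a\<bar> powr (- 1 / 2)) * indicator {a - 1..a + 1} t) \<partial>lborel) < \<infinity>"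
proof -
  define h where "h t = t powr (- 1 / 2) * indicator {0..1} t" for t :: real
  have [measurable]: "h \<in> borel_measurable borel" by (simp add: h_def[abs_def])
  have h: "(\<integral>\<^sup>+t. ennreal (h t) \<partial>lborel) = ennreal 2"
  proof (rule nn_integral_has_integral_lborel)
    have "((\<lambda>t. t powr (- 1 / 2)) has_integral 2) {0..1 :: real}"
      using has_integral_powr_from_0[of "- 1 / 2" 1] by simp
    then have "((\<lambda>t. if t \<in> {0..1} then t powr (- 1 / 2) else 0) has_integral 2) (UNIV :: real set)"
      by (simp only: has_integral_restrict_UNIV)
    then show "(h has_integral 2) UNIV"
      by (rule has_integral_eq[rotated]) (auto simp: h_def)
  qed (auto simp: h_def)
  \<comment> \<open>Away from \<open>a\<close> the integrand is dominated by a translate of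
    \<open>h\<close> on the right of \<open>a\<close> and a reflected one on the left.\<close>
  have "(\<integral>\<^sup>+t. (if t = a then \<infinity> else ennreal (\<bar>t - a\<bar> powr (- 1 / 2)) * indicator {a - 1..a + 1} t) \<partial>lborel)
      \<le> (\<integral>\<^sup>+t. ennreal (h ((- a) + 1 * t)) + ennreal (h (a + (- 1) * t)) \<partial>lborel)"
  proof (rule nn_integral_mono_AE)
    show "AE t in lborel. (if t = a then \<infinity> else ennreal (\<bar>t - a\<bar> powr (- 1 / 2)) * indicator {a - 1..a + 1} t)
        \<le> ennreal (h ((- a) + 1 * t)) + ennreal (h (a + (- 1) * t))"
      using AE_lborel_singleton[of a] by eventually_elim (auto simp: h_def split: split_indicator)
  qed
  also have "\<dots> = (\<integral>\<^sup>+t. ennreal (h ((- a) + 1 * t)) \<partial>lborel) + (\<integral>\<^sup>+t. ennreal (h (a + (- 1) * t)) \<partial>lborel)"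
    by (rule nn_integral_add) auto
  also have "\<dots> = ennreal 2 + ennreal 2"
    using nn_integral_real_affine[of "\<lambda>t. ennreal (h t)" 1 "- a"]
      nn_integral_real_affine[of "\<lambda>t. ennreal (h t)" "- 1" a] h by simp
  also have "\<dots> < \<infinity>" by simp
  finally show ?thesis .
qed

text \<open>From \<open>\<bar>x\<bar> * \<bar>y\<bar> \<le> (norm z)\<^sup>2\<close> the function
  \<open>1 / norm z\<close> is at most a product of one-variable functions with inverse square root
  singularities, and Tonelli applies.\<close>

lemma set_integrable_inverse_norm_ball:
  fixes p :: complex
  shows "set_integrable lborel (ball p 1) (\<lambda>z. of_real (inverse (norm (z - p))) :: complex)"
proof -
  \<comment> \<open>The value \<infinity> at \<open>a\<close> keeps the product bound valid on the
    two axes through \<open>p\<close>, where a real power of 0 would evaluate to 0.\<close>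
  define g where "g a t = (if t = a then \<infinity> else ennreal (\<bar>t - a\<bar> powr (- 1 / 2)) * indicator {a - 1..a + 1} t)"
    for a t :: real
  have [measurable]: "g a \<in> borel_measurable borel" for a by (simp add: g_def[abs_def])
  define f where "f z = indicator (ball p 1) z *\<^sub>R (of_real (inverse (norm (z - p))) :: complex)" for z
  have [measurable]: "f \<in> borel_measurable borel" unfolding f_def[abs_def]
    by (intro borel_measurable_scaleR borel_measurable_indicator borel_measurable_of_real
        borel_measurable_inverse borel_measurable_norm borel_measurable_diff) auto
  have bound: "ennreal (norm (f (of_real x + of_real y * \<i>))) \<le> g (Re p) x * g (Im p) y" for x y
  proof (cases "of_real x + of_real y * \<i> \<in> ball p 1")
    case True
    define z where "z = of_real x + of_real y * \<i> - p"
    have z: "Re z = x - Re p" "Im z = y - Im p" "norm z < 1"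
      using True by (auto simp: z_def dist_norm norm_minus_commute)
    have abs: "\<bar>x - Re p\<bar> < 1" "\<bar>y - Im p\<bar> < 1"
      using z abs_Re_le_cmod[of z] abs_Im_le_cmod[of z] by auto
    have gy: "g (Im p) y > 0" and gx: "g (Re p) x > 0"
      using abs by (auto simp: g_def split: split_indicator)
    show ?thesis
    proof (cases "x = Re p \<or> y = Im p")
      case True
      then show ?thesis using gx gy by (auto simp: g_def[of "Re p" "Re p"] g_def[of "Im p" "Im p"]
        ennreal_top_mult ennreal_mult_top)
    next
      case False
      have "(\<bar>x - Re p\<bar> * \<bar>y - Im p\<bar>) powr (1 / 2) \<le> (norm z * norm z) powr (1 / 2)"
        using z abs_Re_le_cmod[of z] abs_Im_le_cmod[of z] by (intro powr_mono2 mult_mono) auto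
      also have "\<dots> = norm z" by (simp add: powr_half_sqrt)
      finally have "inverse (norm z) \<le> inverse ((\<bar>x - Re p\<bar> * \<bar>y - Im p\<bar>) powr (1 / 2))"
        using False by (intro le_imp_inverse_le) auto
      also have "\<dots> = \<bar>x - Re p\<bar> powr (- 1 / 2) * \<bar>y - Im p\<bar> powr (- 1 / 2)"
        by (simp add: powr_minus powr_mult)
      finally have "norm (f (of_real x + of_real y * \<i>)) \<le> \<bar>x - Re p\<bar> powr (- 1 / 2) * \<bar>y - Im p\<bar> powr (- 1 / 2)"
        using True by (simp add: f_def z_def norm_inverse)
      moreover have "g (Re p) x * g (Im p) y = ennreal (\<bar>x - Re p\<bar> powr (- 1 / 2) * \<bar>y - Im p\<bar> powr (- 1 / 2))"
        using False abs by (auto simp: g_def ennreal_mult split: split_indicator)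
      ultimately show ?thesis by (simp add: ennreal_leI)
    qed
  qed (auto simp: f_def)
  have "(\<integral>\<^sup>+(x, y). ennreal (norm (f (of_real x + of_real y * \<i>))) \<partial>(lborel \<Otimes>\<^sub>M lborel))
      \<le> (\<integral>\<^sup>+(x, y). g (Re p) x * g (Im p) y \<partial>(lborel \<Otimes>\<^sub>M lborel))"
    using bound by (intro nn_integral_mono) auto
  also have "\<dots> = (\<integral>\<^sup>+x. (\<integral>\<^sup>+y. g (Re p) x * g (Im p) y \<partial>lborel) \<partial>lborel)"
    by (subst lborel.nn_integral_fst[symmetric]) auto
  also have "\<dots> = (\<integral>\<^sup>+x. g (Re p) x \<partial>lborel) * (\<integral>\<^sup>+y. g (Im p) y \<partial>lborel)"
    by (simp add: nn_integral_cmult nn_integral_multc)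
  also have "\<dots> < \<infinity>"
    using nn_integral_inverse_sqrt_finite by (auto simp: g_def[abs_def] ennreal_mult_less_top)
  finally have "integrable (lborel \<Otimes>\<^sub>M lborel) (\<lambda>(x, y). f (of_real x + of_real y * \<i>))"
    by (intro integrableI_bounded) (auto simp: case_prod_unfold)
  \<comment> \<open>Skew coordinates for \<open>\<i>\<close> are the Cartesian ones.\<close>
  then have "integrable lborel f"
    by (subst integrable_skew_coordinates[of \<i>]) auto
  then show ?thesis by (simp add: set_integrable_def f_def[abs_def])
qed

text \<open>Each point of \<open>S\<close>, pole or not, has a ball on which \<open>K\<close> is
  dominated by a multiple of \<open>1 / norm (z - p)\<close>; compactness leaves finitely many
  balls. The set \<open>T\<close> is separate from \<open>S\<close> because the half-open cell is
  not compact.\<close>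

lemma set_integrable_simple_poles:
  fixes K :: "complex \<Rightarrow> complex"
  assumes K: "K \<in> borel_measurable borel" and "compact S" and T: "T \<in> sets borel" "T \<subseteq> S"
    and bound: "\<And>p. p \<in> S \<Longrightarrow> \<exists>C. \<forall>\<^sub>F z in at p. norm (K z) \<le> C / norm (z - p)"
  shows "set_integrable lborel T K"
proof -
  note [measurable] = K
  have "\<exists>U. open U \<and> p \<in> U \<and> set_integrable lborel U K" if p: "p \<in> S" for p
  proof -
    obtain C where "\<forall>\<^sub>F z in at p. norm (K z) \<le> C / norm (z - p)"
      using bound[OF p] by auto
    then obtain r where r: "r > 0" "\<And>z. z \<noteq> p \<Longrightarrow> dist z p < r \<Longrightarrow> norm (K z) \<le> C / norm (z - p)"
      by (auto simp: eventually_at)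
    define U where "U = ball p (min r 1)"
    have "set_integrable lborel (ball p 1) (\<lambda>z. of_real C * of_real (inverse (norm (z - p))) :: complex)"
      using set_integrable_inverse_norm_ball by (rule set_integrable_mult_right)
    then have int: "set_integrable lborel U (\<lambda>z. of_real C * of_real (inverse (norm (z - p))) :: complex)"
      by (rule set_integrable_subset) (auto simp: U_def)
    have "set_integrable lborel U K"
      unfolding set_integrable_def
    proof (rule Bochner_Integration.integrable_bound[OF int[unfolded set_integrable_def]])
      have "norm (indicator U z *\<^sub>R K z) \<le>
        norm (indicator U z *\<^sub>R (of_real C * of_real (inverse (norm (z - p))) :: complex))" if "z \<noteq> p" for z
      proof (cases "z \<in> U")
        case True
        then have "norm (K z) \<le> C / norm (z - p)" using r(2) that by (auto simp: U_def dist_commute)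
        also have "\<dots> \<le> norm (of_real C * of_real (inverse (norm (z - p))) :: complex)"
          by (simp add: norm_mult norm_inverse divide_inverse mult_right_mono)
        finally show ?thesis using True by simp
      qed simp
      with AE_lborel_singleton[of p]
      show "AE z in lborel. norm (indicator U z *\<^sub>R K z) \<le>
        norm (indicator U z *\<^sub>R (of_real C * of_real (inverse (norm (z - p))) :: complex))"
        by (auto elim!: eventually_mono)
    qed (auto simp: U_def intro!: borel_measurable_scaleR borel_measurable_indicator K)
    then show ?thesis using r(1) by (intro exI[of _ U]) (auto simp: U_def)
  qed
  then obtain U where U: "\<And>p. p \<in> S \<Longrightarrow> open (U p) \<and> p \<in> U p \<and> set_integrable lborel (U p) K"
    by metis
  obtain P where P: "P \<subseteq> S" "finite P" "S \<subseteq> (\<Union>p\<in>P. U p)"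
    using compactE_image[OF \<open>compact S\<close>, of S U] U by blast
  have "set_integrable lborel (\<Union>p\<in>P. U p) K"
    using P(2,1) by (intro set_integrable_UN) (use U in auto)
  then show ?thesis
    by (rule set_integrable_subset) (use T P in auto)
qed

section \<open>Integrals over a period cell\<close>

lemma skew_coordinates_inject:
  assumes "Im \<tau> > 0" "of_real x + of_real y * \<tau> = of_real x' + of_real y' * \<tau>"
  shows "x = x'" "y = y'"
proof -
  have "Im (of_real x + of_real y * \<tau>) = Im (of_real x' + of_real y' * \<tau>)"
    "Re (of_real x + of_real y * \<tau>) = Re (of_real x' + of_real y' * \<tau>)" using assms by simp_all
  then show "x = x'" "y = y'" using assms(1) by auto
qed

lemma skew_coordinates_exist:
  assumes "Im \<tau> > 0"
  shows "z = of_real (Re z - Im z / Im \<tau> * Re \<tau>) + of_real (Im z / Im \<tau>) * \<tau>"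
  using assms by (simp add: complex_eq_iff)

lemma mem_fundamental_cell_iff:
  assumes "Im \<tau> > 0"
  shows "of_real x + of_real y * \<tau> \<in> fundamental_cell \<tau> \<longleftrightarrow> x \<in> {0..<1} \<and> y \<in> {0..<1}"
  unfolding fundamental_cell_def using skew_coordinates_inject[OF assms] by blast

lemma fundamental_cell_subset: "fundamental_cell \<tau> \<subseteq> cball 0 (1 + norm \<tau>)"
proof
  fix z assume "z \<in> fundamental_cell \<tau>"
  then obtain a b where "z = of_real a + of_real b * \<tau>" "a \<in> {0..<1}" "b \<in> {0..<1}"
    by (auto simp: fundamental_cell_def)
  then have "norm z \<le> norm (of_real a :: complex) + norm (of_real b * \<tau>)"
    by (simp only: norm_triangle_ineq)
  moreover have "\<bar>a\<bar> \<le> 1" "\<bar>b\<bar> * norm \<tau> \<le> 1 * norm \<tau>"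
    using \<open>a \<in> _\<close> \<open>b \<in> _\<close> by (auto intro!: mult_left_le_one_le)
  ultimately show "z \<in> cball 0 (1 + norm \<tau>)" by (simp add: norm_mult)
qed

lemma fundamental_cell_borel:
  assumes "Im \<tau> > 0"
  shows "fundamental_cell \<tau> \<in> sets borel"
proof -
  have "fundamental_cell \<tau> = {z \<in> space borel. Re z - Im z / Im \<tau> * Re \<tau> \<in> {0..<1} \<and> Im z / Im \<tau> \<in> {0..<1}}"
    using mem_fundamental_cell_iff[OF assms] skew_coordinates_exist[OF assms]
    by (metis (mono_tags, lifting) Collect_cong Collect_mem_eq UNIV_I space_borel)
  also have "\<dots> \<in> sets borel" by measurable
  finally show ?thesis .
qed

lemma ex1_lattice_translate_in_cell:
  assumes "Im \<tau> > 0"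
  shows "\<exists>!z. z \<in> fundamental_cell \<tau> \<and> z - p \<in> lattice \<tau>"
proof -
  obtain x y where p: "p = of_real x + of_real y * \<tau>"
    using skew_coordinates_exist[OF assms] by blast
  define w where "w = of_real (frac x) + of_real (frac y) * \<tau>"
  show ?thesis
  proof (rule ex1I[of _ w])
    have "w - p = of_int (- \<lfloor>x\<rfloor>) + of_int (- \<lfloor>y\<rfloor>) * \<tau>"
      by (simp add: w_def p frac_def algebra_simps)
    then have "w - p \<in> lattice \<tau>" unfolding lattice_def by blast
    then show "w \<in> fundamental_cell \<tau> \<and> w - p \<in> lattice \<tau>"
      using mem_fundamental_cell_iff[OF assms] by (simp add: w_def frac_lt_1)
  next
    fix z assume z: "z \<in> fundamental_cell \<tau> \<and> z - p \<in> lattice \<tau>"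
    then obtain a b where ab: "z = of_real a + of_real b * \<tau>" "a \<in> {0..<1}" "b \<in> {0..<1}"
      by (auto simp: fundamental_cell_def)
    obtain i j where ij: "z - p = of_int i + of_int j * \<tau>" using z by (auto simp: lattice_def)
    have "of_real a + of_real b * \<tau> = of_real (x + of_int i) + of_real (y + of_int j) * \<tau>"
      using ab ij p by (simp add: algebra_simps)
    from skew_coordinates_inject[OF assms this] have "a = x + of_int i" "b = y + of_int j" by simp_all
    then have "frac x = a" "frac y = b"
      using ab(2,3) frac_unique_iff[of x a] frac_unique_iff[of y b] by auto
    then show "z = w" by (simp add: w_def ab)
  qed
qed

lemma countable_lattice: "countable (lattice \<tau>)"
proof -
  have "lattice \<tau> = (\<lambda>(a, b). of_int a + of_int b * \<tau>) ` (UNIV :: (int \<times> int) set)"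
    by (auto simp: lattice_def)
  then show ?thesis by simp
qed

text \<open>The parameters of the lines that meet \<open>D\<close> form the image of
  \<open>D\<close> under a coordinate projection, a countable and hence null set. Thus on almost
  every line in a period direction the function under study has no singularity at all.\<close>

lemma AE_skew_line_avoids:
  assumes "Im \<tau> > 0" "countable D"
  shows "AE y in lborel. \<forall>x. of_real x + of_real y * \<tau> \<notin> D"
    and "AE x in lborel. \<forall>y. of_real x + of_real y * \<tau> \<notin> D"
proof -
  define Y where "Y = (\<lambda>z. Im z / Im \<tau>) ` D"
  have "AE y in lborel. y \<notin> Y"
    using assms(2) by (intro AE_not_in countable_imp_null_set_lborel) (auto simp: Y_def)
  moreover have "y \<in> Y" if "of_real x + of_real y * \<tau> \<in> D" for x y
    using that assms(1) unfolding Y_def by (intro image_eqI[OF _ that]) simp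
  ultimately show "AE y in lborel. \<forall>x. of_real x + of_real y * \<tau> \<notin> D"
    by (auto elim!: eventually_mono)
next
  define X where "X = (\<lambda>z. Re z - Im z / Im \<tau> * Re \<tau>) ` D"
  have "AE x in lborel. x \<notin> X"
    using assms(2) by (intro AE_not_in countable_imp_null_set_lborel) (auto simp: X_def)
  moreover have "x \<in> X" if "of_real x + of_real y * \<tau> \<in> D" for x y
    using that assms(1) unfolding X_def by (intro image_eqI[OF _ that]) simp
  ultimately show "AE x in lborel. \<forall>y. of_real x + of_real y * \<tau> \<notin> D"
    by (auto elim!: eventually_mono)
qed

section \<open>Integrals of derivatives of periodic functions\<close>

lemma integral_derivative_unit_interval_eq_0:
  fixes F F' :: "real \<Rightarrow> complex"
  assumes "\<And>x. (F has_vector_derivative F' x) (at x)" "continuous_on UNIV F'" "F 1 = F 0"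
  shows "(\<integral>x. indicator {0..<1} x *\<^sub>R F' x \<partial>lborel) = 0"
proof -
  \<comment> \<open>The cell is half-open while the fundamental theorem of calculus is applied on
    the closed interval; they differ by a null set.\<close>
  have "(\<integral>x. indicator {0..<1} x *\<^sub>R F' x \<partial>lborel) = (\<integral>x. indicator {0..1} x *\<^sub>R F' x \<partial>lborel)"
  proof (rule integral_cong_AE)
    have [measurable]: "F' \<in> borel_measurable borel"
      using assms(2) by (rule borel_measurable_continuous_onI)
    show "(\<lambda>x. indicator {0..<1} x *\<^sub>R F' x) \<in> borel_measurable lborel"
      "(\<lambda>x. indicator {0..1} x *\<^sub>R F' x) \<in> borel_measurable lborel" by measurable
    show "AE x in lborel. indicator {0..<1} x *\<^sub>R F' x = indicator {0..1} x *\<^sub>R F' x"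
      using AE_lborel_singleton[of "1 :: real"] by eventually_elim (auto split: split_indicator)
  qed
  also have "\<dots> = F 1 - F 0"
    by (rule integral_FTC_Icc) (auto intro: has_vector_derivative_at_within assms continuous_on_subset)
  finally show ?thesis using assms(3) by simp
qed

text \<open>On almost every line in direction \<open>v\<close> the derivative integrates to the
  difference of \<open>H\<close> over one period, which is 0. Integrability of \<open>X\<close>
  across the singularities is what licenses Fubini; the function \<open>X\<close> is a Borel version
  of the derivative on the whole plane.\<close>

lemma integral_cell_derivative_eq_0:
  fixes H :: "complex \<Rightarrow> complex"
  assumes tau: "Im \<tau> > 0" and D: "countable D"
    and H: "\<And>z. z \<notin> D \<Longrightarrow> (H has_derivative H' z) (at z)"
    and period: "\<And>z. z \<notin> D \<Longrightarrow> H (z + v) = H z"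
    and v: "v = 1 \<or> v = \<tau>"
    and X: "X \<in> borel_measurable borel" "continuous_on (- D) X" "\<And>z. z \<notin> D \<Longrightarrow> X z = H' z v"
    and int: "set_integrable lborel (fundamental_cell \<tau>) X"
  shows "(LINT z:fundamental_cell \<tau>|lborel. X z) = 0"
proof -
  have line: "(\<integral>t. indicator {0..<1} t *\<^sub>R X (w + of_real t * v) \<partial>lborel) = 0"
    if w: "\<And>t. w + of_real t * v \<notin> D" for w
  proof (rule integral_derivative_unit_interval_eq_0)
    fix t
    have "((\<lambda>t. w + of_real t * v) has_derivative (\<lambda>s. of_real s * v)) (at t)"
      by (auto intro!: derivative_eq_intros)
    from has_derivative_compose[OF this H[OF w]]
    have *: "((\<lambda>t. H (w + of_real t * v)) has_derivative (\<lambda>s. H' (w + of_real t * v) (of_real s * v))) (at t)" .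
    have "H' (w + of_real t * v) (of_real s * v) = s *\<^sub>R H' (w + of_real t * v) v" for s
      using linear_cmul[OF has_derivative_linear[OF H[OF w[of t]]], of s v] by (simp add: scaleR_conv_of_real)
    with * show "((\<lambda>t. H (w + of_real t * v)) has_vector_derivative X (w + of_real t * v)) (at t)"
      by (simp add: has_vector_derivative_def X(3)[OF w])
  next
    show "continuous_on UNIV (\<lambda>t. X (w + of_real t * v))"
      by (rule continuous_on_compose2[OF X(2)]) (auto intro!: continuous_intros simp: w)
  next
    show "H (w + of_real 1 * v) = H (w + of_real 0 * v)"
      using period[of w] w[of 0] by simp
  qed
  define f where "f z = indicator (fundamental_cell \<tau>) z *\<^sub>R X z" for z
  have f_eq: "f (of_real x + of_real y * \<tau>) =
      indicator {0..<1} y *\<^sub>R (indicator {0..<1} x *\<^sub>R X (of_real x + of_real y * \<tau>))" for x y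
    using mem_fundamental_cell_iff[OF tau, of x y] by (auto simp: f_def split: split_indicator)
  have meas: "f \<in> borel_measurable borel" unfolding f_def[abs_def]
    by (intro borel_measurable_scaleR borel_measurable_indicator fundamental_cell_borel tau X)
  have "integrable lborel f" using int by (simp add: set_integrable_def f_def[abs_def])
  then have prod: "integrable (lborel \<Otimes>\<^sub>M lborel) (\<lambda>(x, y). f (of_real x + of_real y * \<tau>))"
    using integrable_skew_coordinates[OF tau meas] by simp
  have "integral\<^sup>L (lborel \<Otimes>\<^sub>M lborel) (\<lambda>(x, y). f (of_real x + of_real y * \<tau>)) = 0"
    using v
  \<comment> \<open>The inner integration runs along the period \<open>v\<close>: over
    \<open>x\<close> if \<open>v = 1\<close>, over \<open>y\<close> if
    \<open>v = \<tau>\<close>.\<close>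
  proof
    assume "v = 1"
    have "AE y in lborel. (\<integral>x. f (of_real x + of_real y * \<tau>) \<partial>lborel) = 0"
      using AE_skew_line_avoids(1)[OF tau D]
    proof eventually_elim
      case (elim y)
      then show ?case using line[of "of_real y * \<tau>"] by (simp add: f_eq \<open>v = 1\<close> add.commute del: scaleR_scaleR)
    qed
    then show ?thesis
      by (subst lborel_pair.integral_snd[OF prod, symmetric]) (rule integral_eq_zero_AE)
  next
    assume "v = \<tau>"
    have "AE x in lborel. (\<integral>y. f (of_real x + of_real y * \<tau>) \<partial>lborel) = 0"
      using AE_skew_line_avoids(2)[OF tau D]
    proof eventually_elim
      case (elim x)
      then show ?case using line[of "of_real x"]
        by (subst f_eq, subst scaleR_left_commute) (simp add: \<open>v = \<tau>\<close> del: scaleR_scaleR)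
    qed
    then show ?thesis
      by (subst lborel_pair.integral_fst[OF prod, symmetric]) (rule integral_eq_zero_AE)
  qed
  then show ?thesis
    using integral_skew_coordinates[OF tau meas] by (simp add: set_lebesgue_integral_def f_def[abs_def])
qed

lemma tendsto_imp_eventually_norm_le:
  assumes "(f \<longlongrightarrow> l) F"
  shows "\<forall>\<^sub>F x in F. norm (f x) \<le> norm l + 1"
  using order_tendstoD(2)[OF tendsto_norm[OF assms], of "norm l + 1"]
  by (auto elim: eventually_mono)

lemma simple_zero_quotient_tendsto:
  assumes "h holomorphic_on UNIV" "h p = 0" "deriv h p \<noteq> 0"
  shows "((\<lambda>z. (z - p) / h z) \<longlongrightarrow> inverse (deriv h p)) (at p)"
proof -
  have "((\<lambda>z. (h z - h p) / (z - p)) \<longlongrightarrow> deriv h p) (at p)"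
    using holomorphic_derivI[OF assms(1) open_UNIV UNIV_I, of p] by (simp add: has_field_derivative_iff)
  from tendsto_inverse[OF this assms(3)] show ?thesis using assms(2) by simp
qed

text \<open>Near a simple zero \<open>p\<close> of \<open>h\<close> where \<open>f\<close> vanishes
  too, \<open>f\<close> is \<open>O(norm (z - p))\<close>, so both terms of the quotient rule for
  \<open>f / h\<close> are \<open>O(1 / norm (z - p))\<close>. The derivatives along the two periods
  are therefore integrable with integral 0, and so is their combination
  \<open>d / h\<close>.\<close>

lemma integral_cell_dbar_eq_0:
  assumes tau: "Im \<tau> > 0" and h: "h holomorphic_on UNIV"
    and D: "countable D" "\<And>z. h z = 0 \<longleftrightarrow> z \<in> D" "\<And>z. z \<in> D \<Longrightarrow> deriv h z \<noteq> 0"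
    and f: "f \<in> real_analytic_algebra" "\<And>z. z \<in> D \<Longrightarrow> f z = 0"
    and period: "\<And>z l. z \<notin> D \<Longrightarrow> l \<in> lattice \<tau> \<Longrightarrow> f (z + l) / h (z + l) = f z / h z"
    and d: "\<And>z. has_dbar \<tau> f (d z) z"
  shows "set_integrable lborel (fundamental_cell \<tau>) (\<lambda>z. d z / h z)"
    and "(LINT z:fundamental_cell \<tau>|lborel. d z / h z) = 0"
proof -
  obtain f' where f': "\<And>z. (f has_derivative f' z) (at z)" "\<And>v. (\<lambda>z. f' z v) \<in> real_analytic_algebra"
    using real_analytic_algebra_has_derivative[OF f(1)] by blast
  note cont = real_analytic_algebra_continuous[OF f(1)] real_analytic_algebra_continuous[OF f'(2)]
    holomorphic_on_imp_continuous_on[OF holomorphic_on_subset[OF h]]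
    holomorphic_on_imp_continuous_on[OF holomorphic_on_subset[OF holomorphic_deriv[OF h open_UNIV]]]
  \<comment> \<open>The quotient rule in direction \<open>v\<close>; division by zero extends it by
    0 to the zeros of \<open>h\<close>, which yields a Borel function on the plane.\<close>
  define X where "X v z = (f' z v * h z - f z * (deriv h z * v)) / (h z)\<^sup>2" for v z
  have meas: "X v \<in> borel_measurable borel" for v
    unfolding X_def[abs_def]
    by (intro borel_measurable_divide borel_measurable_continuous_onI continuous_intros cont) auto
  have contX: "continuous_on (- D) (X v)" for v
    unfolding X_def[abs_def] by (intro continuous_intros cont) (use D in auto)
  have "\<exists>C. \<forall>\<^sub>F z in at p. norm (X v z) \<le> C / norm (z - p)" for v p
  proof (cases "p \<in> D")
    case False
    have "open (- D)"
    proof -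
      have "- D = h -` (- {0})" using D(2) by auto
      then show ?thesis using open_vimage[of "- {0}" h] cont(3)[of UNIV] by auto
    qed
    then have "isCont (X v) p" using contX[of v] False by (simp add: continuous_on_eq_continuous_at)
    then have "\<forall>\<^sub>F z in at p. norm (X v z) \<le> norm (X v p) + 1"
      by (intro tendsto_imp_eventually_norm_le) (simp add: isCont_def)
    moreover have "\<forall>\<^sub>F z in at p. norm (z - p) < 1"
      using eventually_at_ball[of 1 p UNIV] by (auto simp: dist_norm norm_minus_commute elim: eventually_mono)
    \<comment> \<open>Within distance 1, dividing a constant by the distance only enlarges it, so
      regular points satisfy a bound of the same form as poles.\<close>
    ultimately have "\<forall>\<^sub>F z in at p. norm (X v z) \<le> (norm (X v p) + 1) / norm (z - p)"
      using eventually_neq_at_within[of p p UNIV]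
    proof eventually_elim
      case (elim z)
      have "(norm (X v p) + 1) * 1 \<le> (norm (X v p) + 1) / norm (z - p)"
        using elim mult_left_le[of "norm (z - p)" "norm (X v p) + 1"] by (simp add: le_divide_eq)
      with elim show ?case by simp
    qed
    then show ?thesis by blast
  next
    case True
    obtain K where K: "\<And>x. norm (f' p x) \<le> norm x * K"
      using has_derivative_bounded_linear[OF f'(1)] bounded_linear.bounded by blast
    have "\<forall>\<^sub>F z in nhds p. norm (f z - f p - f' p (z - p)) \<le> 1 * norm (z - p)"
      using f'(1)[of p] unfolding has_derivative_at_alt eventually_nhds_metric dist_norm
      by (meson zero_less_one)
    then have "\<forall>\<^sub>F z in at p. norm (f z - f p - f' p (z - p)) \<le> 1 * norm (z - p)"
      by (auto simp: eventually_at_filter elim: eventually_mono)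
    \<comment> \<open>\<open>K\<close> bounds the derivative at \<open>p\<close>, the extra 1 the
      remainder, and \<open>f p = 0\<close> removes the constant term.\<close>
    then have "\<forall>\<^sub>F z in at p. norm (f z) \<le> (K + 1) * norm (z - p)"
    proof eventually_elim
      case (elim z)
      then have "norm (f z - f' p (z - p)) \<le> norm (z - p)" using f(2)[OF True] by simp
      moreover have "norm (f z) \<le> norm (f z - f' p (z - p)) + norm (f' p (z - p))"
        by (metis diff_add_cancel norm_triangle_ineq)
      ultimately show ?case using K[of "z - p"] by (simp add: algebra_simps)
    qed
    moreover define c1 where "c1 = norm (inverse (deriv h p)) + 1"
    have "\<forall>\<^sub>F z in at p. norm ((z - p) / h z) \<le> c1"
      unfolding c1_def
      using h D True by (intro tendsto_imp_eventually_norm_le simple_zero_quotient_tendsto) auto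
    moreover define c2 where "c2 = norm (f' p v) + 1"
    have "\<forall>\<^sub>F z in at p. norm (f' z v) \<le> c2"
      unfolding c2_def using cont(2)[of UNIV v]
      by (intro tendsto_imp_eventually_norm_le) (auto simp: continuous_on_def)
    moreover define c3 where "c3 = norm (deriv h p * v) + 1"
    have "continuous_on UNIV (\<lambda>z. deriv h z * v)" by (intro continuous_intros cont) auto
    then have "\<forall>\<^sub>F z in at p. norm (deriv h z * v) \<le> c3"
      unfolding c3_def by (intro tendsto_imp_eventually_norm_le) (auto simp: continuous_on_def)
    ultimately have "\<forall>\<^sub>F z in at p. norm (X v z) \<le> (c2 * c1 + (K + 1) * c3 * c1\<^sup>2) / norm (z - p)"
      using eventually_neq_at_within[of p p UNIV]
    proof eventually_elim
      case (elim z)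
      define Q where "Q = (z - p) / h z"
      have nz: "norm (z - p) > 0" using elim by simp
      \<comment> \<open>Each \<open>1 / h\<close> is paired with a factor \<open>z - p\<close> into
        the bounded quotient \<open>Q\<close>; in the second term one more \<open>z - p\<close> is
        absorbed by the vanishing of \<open>f\<close>.\<close>
      have "X v z * (z - p) = f' z v * Q - f z / (z - p) * (deriv h z * v) * Q\<^sup>2"
      proof (cases "h z = 0")
        case False
        have "(a * k - b * c) / k\<^sup>2 * w = a * (w / k) - b / w * c * (w / k)\<^sup>2"
          if "k \<noteq> 0" "w \<noteq> 0" for a b c k w :: complex
          using that by (simp add: field_simps power2_eq_square)
        then show ?thesis using False nz by (simp add: X_def Q_def)
      qed (simp add: X_def Q_def)
      then have "norm (X v z) * norm (z - p) \<le> norm (f' z v) * norm Q + norm (f z / (z - p)) * norm (deriv h z * v) * (norm Q)\<^sup>2"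
        by (metis norm_mult norm_power norm_triangle_ineq4)
      also have "\<dots> \<le> c2 * c1 + (K + 1) * c3 * c1\<^sup>2"
      proof -
        have fK: "norm (f z / (z - p)) \<le> K + 1"
          using elim(1) nz by (simp add: norm_divide divide_le_eq)
        have Q: "norm Q \<le> c1" using elim by (simp add: Q_def)
        have "0 \<le> K + 1" using fK norm_ge_zero order_trans by blast
        moreover have "0 \<le> c1" "0 \<le> c2" "0 \<le> c3" by (simp_all add: c1_def c2_def c3_def)
        ultimately show ?thesis
          by (intro add_mono mult_mono power_mono elim fK Q mult_nonneg_nonneg zero_le_power norm_ge_zero)
      qed
      finally show ?case using nz by (simp add: le_divide_eq)
    qed
    then show ?thesis by blast
  qed
  then have int: "set_integrable lborel (fundamental_cell \<tau>) (X v)" for v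
    by (intro set_integrable_simple_poles[OF meas compact_cball fundamental_cell_borel[OF tau]
      fundamental_cell_subset]) auto
  have der: "((\<lambda>z. f z / h z) has_derivative (\<lambda>v. X v z)) (at z)" if "z \<notin> D" for z
  proof -
    have "(h has_derivative (\<lambda>v. deriv h z * v)) (at z)"
      using h by (metis UNIV_I has_field_derivative_def holomorphic_derivI open_UNIV)
    from has_derivative_divide'[OF f'(1) this] show ?thesis
      using D(2)[of z] that by (simp add: X_def power2_eq_square)
  qed
  have zero: "(LINT z:fundamental_cell \<tau>|lborel. X v z) = 0" if "v = 1 \<or> v = \<tau>" for v
    using that by (intro integral_cell_derivative_eq_0[OF tau D(1) der _ that meas contX _ int])
      (auto intro: period)
  \<comment> \<open>The terms with \<open>deriv h\<close> cancel, as
    \<open>deriv h z * \<tau>\<close> is \<tau> times \<open>deriv h z * 1\<close>: a holomorphic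
    denominator passes through the operator.\<close>
  have eq: "d z / h z = X \<tau> z - \<tau> * X 1 z" for z
  proof -
    obtain g where "(f has_derivative g) (at z)" "g \<tau> - \<tau> * g 1 = d z"
      using d[of z] by (auto simp: has_dbar_def)
    then have "f' z \<tau> - \<tau> * f' z 1 = d z"
      using has_derivative_unique[OF f'(1)] by blast
    then show ?thesis
      by (cases "h z = 0") (simp_all add: X_def field_simps power2_eq_square)
  qed
  show "set_integrable lborel (fundamental_cell \<tau>) (\<lambda>z. d z / h z)"
    unfolding eq by (intro set_integral_diff(1) set_integrable_mult_right int)
  show "(LINT z:fundamental_cell \<tau>|lborel. d z / h z) = 0"
    unfolding eq using zero by (subst set_integral_diff(2)) (auto intro: int)
qed

section \<open>Products with two poles\<close>

text \<open>As \<open>f\<close> need not be holomorphic, its contour integral may depend on the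
  radius. Subtracting \<open>L / (z - p)\<close>, which contributes exactly
  \<open>2 * pi * \<i> * L\<close>, leaves a remainder \<open>o(1 / \<epsilon>)\<close> on a circle
  of length \<open>2 * pi * \<epsilon>\<close>.\<close>

lemma contour_integral_circlepath_tendsto:
  assumes cont: "continuous_on (ball p r - {p}) f" and "r > 0"
    and lim: "((\<lambda>z. (z - p) * f z) \<longlongrightarrow> L) (at p)"
  shows "((\<lambda>\<epsilon>. contour_integral (circlepath p \<epsilon>) f) \<longlongrightarrow> 2 * pi * \<i> * L) (at_right 0)"
proof (rule tendstoI)
  fix e :: real assume "e > 0"
  \<comment> \<open>Chosen so that \<open>(B / \<epsilon>) * (2 * pi * \<epsilon>)\<close> equals
    \<open>e / 2\<close>.\<close>
  define B where "B = e / (4 * pi)"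
  have "B > 0" using \<open>e > 0\<close> by (simp add: B_def)
  then obtain d where d: "d > 0" "\<And>z. z \<noteq> p \<Longrightarrow> dist z p < d \<Longrightarrow> dist ((z - p) * f z) L < B"
    using lim unfolding tendsto_iff eventually_at by auto
  have "\<forall>\<^sub>F \<epsilon> in at_right 0. \<epsilon> \<in> {0<..<min d r}"
    using d(1) \<open>r > 0\<close> by (intro eventually_at_right_real) auto
  then show "\<forall>\<^sub>F \<epsilon> in at_right 0. dist (contour_integral (circlepath p \<epsilon>) f) (2 * pi * \<i> * L) < e"
  proof eventually_elim
    case (elim \<epsilon>)
    have circle: "path_image (circlepath p \<epsilon>) = sphere p \<epsilon>" using elim by simp
    have "f contour_integrable_on circlepath p \<epsilon>"
      by (intro contour_integrable_continuous_circlepath continuous_on_subset[OF cont])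
        (use elim in \<open>auto simp: dist_norm\<close>)
    then have "(f has_contour_integral contour_integral (circlepath p \<epsilon>) f) (circlepath p \<epsilon>)"
      by (rule has_contour_integral_integral)
    moreover have "((\<lambda>z. L / (z - p)) has_contour_integral (2 * pi * \<i> * L)) (circlepath p \<epsilon>)"
      using Cauchy_integral_circlepath_simple[of "\<lambda>_. L" p \<epsilon> p] elim by simp
    ultimately have "((\<lambda>z. f z - L / (z - p)) has_contour_integral
        (contour_integral (circlepath p \<epsilon>) f - 2 * pi * \<i> * L)) (circlepath p \<epsilon>)"
      by (rule has_contour_integral_diff)
    then have "norm (contour_integral (circlepath p \<epsilon>) f - 2 * pi * \<i> * L) \<le> (B / \<epsilon>) * (2 * pi * \<epsilon>)"
    proof (rule has_contour_integral_bound_circlepath)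
      fix z assume z: "norm (z - p) = \<epsilon>"
      have "z \<noteq> p" using z elim by auto
      have "f z - L / (z - p) = ((z - p) * f z - L) / (z - p)"
        using \<open>z \<noteq> p\<close> by (simp add: field_simps)
      moreover have "norm ((z - p) * f z - L) < B"
        using d(2)[of z] \<open>z \<noteq> p\<close> z elim by (simp add: dist_norm)
      ultimately show "norm (f z - L / (z - p)) \<le> B / \<epsilon>"
        using z elim by (simp add: norm_divide divide_right_mono)
    qed (use \<open>B > 0\<close> elim in auto)
    also have "\<dots> = e / 2" using elim by (simp add: B_def field_simps)
    finally show ?case using \<open>e > 0\<close> by (simp add: dist_norm)
  qed
qed

lemma finite_on_torus_two_translates:
  assumes "Im \<tau> > 0"
  obtains p' q' where "p' - p \<in> lattice \<tau>" "q' - q \<in> lattice \<tau>"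
    "{z. z - p \<in> lattice \<tau> \<or> q - z \<in> lattice \<tau>} \<inter> fundamental_cell \<tau> = {p', q'}"
proof -
  obtain p' where p': "p' \<in> fundamental_cell \<tau>" "p' - p \<in> lattice \<tau>"
    "\<And>z. z \<in> fundamental_cell \<tau> \<Longrightarrow> z - p \<in> lattice \<tau> \<Longrightarrow> z = p'"
    using ex1_lattice_translate_in_cell[OF assms, of p] by blast
  obtain q' where q': "q' \<in> fundamental_cell \<tau>" "q' - q \<in> lattice \<tau>"
    "\<And>z. z \<in> fundamental_cell \<tau> \<Longrightarrow> z - q \<in> lattice \<tau> \<Longrightarrow> z = q'"
    using ex1_lattice_translate_in_cell[OF assms, of q] by blast
  have flip: "q - z \<in> lattice \<tau> \<longleftrightarrow> z - q \<in> lattice \<tau>" for z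
    using lattice_minus_iff[of "z - q" \<tau>] by simp
  have "{z. z - p \<in> lattice \<tau> \<or> q - z \<in> lattice \<tau>} \<inter> fundamental_cell \<tau> = {p', q'}"
    unfolding flip using p' q' by blast
  with p'(2) q'(2) show ?thesis by (rule that)
qed

lemma eventually_nonzero_at_simple_zeros:
  assumes "h holomorphic_on UNIV" "h p = 0 \<Longrightarrow> deriv h p \<noteq> 0"
  shows "\<forall>\<^sub>F z in at p. h z \<noteq> 0"
proof (cases "h p = 0")
  case True
  have "((\<lambda>z. (z - p) / h z) \<longlongrightarrow> inverse (deriv h p)) (at p)"
    using assms True by (intro simple_zero_quotient_tendsto) auto
  \<comment> \<open>A nonzero quotient forces a nonzero denominator, since division by zero gives
    0.\<close>
  from tendsto_imp_eventually_ne[OF this, of 0] have "\<forall>\<^sub>F z in at p. (z - p) / h z \<noteq> 0"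
    using assms True by simp
  then show ?thesis by (auto elim: eventually_mono)
next
  case False
  have "(h \<longlongrightarrow> h p) (at p)"
    using holomorphic_on_imp_continuous_on[OF assms(1)] by (simp add: continuous_on_def)
  from tendsto_imp_eventually_ne[OF this False] show ?thesis .
qed

context kronecker_eisenstein
begin

lemma theta_continuous: "continuous_on S \<theta>"
  by (rule holomorphic_on_imp_continuous_on[OF theta_holomorphic])

lemma N_continuous: "continuous_on S (N m)"
  by (rule real_analytic_algebra_continuous[OF N_algebra])

lemma open_compl_lattice: "open (- \<Lambda>)"
proof -
  have "- \<Lambda> = \<theta> -` (- {0})" using theta_eq_0_iff by auto
  then show ?thesis using open_vimage[of "- {0}" \<theta>] theta_continuous by auto
qed

lemma E_continuous: "continuous_on (- \<Lambda>) (E m)"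
proof -
  have "continuous_on (- \<Lambda>) (\<lambda>z. N m z / \<theta> z)"
    by (intro continuous_intros N_continuous theta_continuous) (auto simp: theta_eq_0_iff)
  then show ?thesis by (rule continuous_on_eq) (simp add: E_eq_N_over_theta)
qed

lemma eventually_not_in_lattice: "\<forall>\<^sub>F z in at p. z \<notin> \<Lambda>"
  using eventually_nonzero_at_simple_zeros[OF theta_holomorphic, of p] deriv_theta_nonzero
  by (simp add: theta_eq_0_iff)

text \<open>Periodicity of \<open>N m / \<theta>\<close> gives
  \<open>N m (z + l) * \<theta> z = N m z * \<theta> (z + l)\<close> off the lattice. Dividing by
  \<open>z\<close> and letting \<open>z\<close> tend to 0 transports the value at 0 to every lattice
  point.\<close>

lemma N_lattice:
  assumes l: "l \<in> \<Lambda>"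
  shows "N m l = of_bool (m = 1) * deriv \<theta> l"
proof -
  have shift: "((\<lambda>z. \<theta> (z + l) / z) \<longlongrightarrow> deriv \<theta> l) (at 0)" if "l \<in> \<Lambda>" for l
  proof -
    have "(\<theta> has_field_derivative deriv \<theta> l) (at l)"
      using holomorphic_derivI[OF theta_holomorphic open_UNIV] by auto
    then show ?thesis
      using that by (simp add: DERIV_def add.commute flip: theta_eq_0_iff)
  qed
  have N: "((\<lambda>z. N m (z + l)) \<longlongrightarrow> N m l) (at 0)" for l
  proof -
    have "continuous_on UNIV (\<lambda>z. N m (z + l))"
      by (rule continuous_on_compose2[OF N_continuous[of UNIV m]]) (auto intro!: continuous_intros)
    then have "((\<lambda>z. N m (z + l)) \<longlongrightarrow> N m (0 + l)) (at 0)" unfolding continuous_on_def by blast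
    then show ?thesis by simp
  qed
  have lim1: "((\<lambda>z. N m (z + l) * (\<theta> (z + 0) / z)) \<longlongrightarrow> N m l * deriv \<theta> 0) (at 0)"
    by (intro tendsto_mult N shift) auto
  have ev: "\<forall>\<^sub>F z in at 0. N m (z + 0) * (\<theta> (z + l) / z) = N m (z + l) * (\<theta> (z + 0) / z)"
    using eventually_not_in_lattice[of 0]
  proof eventually_elim
    case (elim z)
    have "N m (z + l) / \<theta> (z + l) = N m z / \<theta> z"
      using E_periodic[OF l, of m z] elim l by (simp add: E_eq_N_over_theta)
    moreover have "\<theta> z \<noteq> 0" "\<theta> (z + l) \<noteq> 0" using elim l by (simp_all add: theta_eq_0_iff)
    ultimately show ?case by (simp add: field_simps)
  qed
  have lim2: "((\<lambda>z. N m (z + 0) * (\<theta> (z + l) / z)) \<longlongrightarrow> N m 0 * deriv \<theta> l) (at 0)"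
    by (intro tendsto_mult N shift l)
  have "N m l * deriv \<theta> 0 = N m 0 * deriv \<theta> l"
    by (rule LIM_unique[OF lim1 Lim_transform_eventually[OF lim2 ev]])
  then show ?thesis by (simp add: deriv_theta_0 N_at_0)
qed

lemma E_lattice_limit:
  assumes l: "l \<in> \<Lambda>"
  shows "((\<lambda>z. (z - l) * E m z) \<longlongrightarrow> of_bool (m = 1)) (at l)"
proof -
  have "((\<lambda>z. N m z * ((z - l) / \<theta> z)) \<longlongrightarrow> N m l * inverse (deriv \<theta> l)) (at l)"
    using l N_continuous[of UNIV m]
    by (intro tendsto_mult simple_zero_quotient_tendsto theta_holomorphic)
      (auto simp: theta_eq_0_iff deriv_theta_nonzero continuous_on_def)
  moreover have "\<forall>\<^sub>F z in at l. N m z * ((z - l) / \<theta> z) = (z - l) * E m z"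
    using eventually_not_in_lattice[of l] by eventually_elim (simp add: E_eq_N_over_theta)
  ultimately have "((\<lambda>z. (z - l) * E m z) \<longlongrightarrow> N m l * inverse (deriv \<theta> l)) (at l)"
    by (rule Lim_transform_eventually)
  then show ?thesis using deriv_theta_nonzero[OF l] by (simp only: N_lattice[OF l]) (simp add: mult.assoc)
qed

definition poles :: "complex \<Rightarrow> complex \<Rightarrow> complex set" where
  "poles p q = {z. z - p \<in> \<Lambda> \<or> q - z \<in> \<Lambda>}"

text \<open>The sum of the residues of \<open>E a (z - p) * E b (q - z)\<close> at \<open>p\<close>
  and \<open>q\<close>, with \<open>w = q - p\<close>. The minus sign stems from the reflected
  argument: \<open>E 1 (q - z)\<close> has residue -1 at \<open>q\<close>.\<close>

definition residue_value :: "nat \<Rightarrow> nat \<Rightarrow> complex \<Rightarrow> complex" where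
  "residue_value a b w = of_bool (a = 1) * E b w - of_bool (b = 1) * E a w"

text \<open>The mean value of \<open>E a (z - p) * E b (q - z)\<close> over the torus, with
  \<open>w = q - p\<close>. The two terms are the coefficients of the poles of the telescoping
  primitive: at \<open>p\<close> only \<open>E 1 (z - p) * E b (q - z)\<close> is singular, which
  needs \<open>a = 0\<close>; at \<open>q\<close> only
  \<open>E (a + b) (z - p) * E 1 (q - z)\<close>, which needs \<open>b > 0\<close>.\<close>

definition integral_value :: "nat \<Rightarrow> nat \<Rightarrow> complex \<Rightarrow> complex" where
  "integral_value a b w = of_bool (a = 0) * E b w - of_bool (b \<noteq> 0) * E (a + b) w"

end

section \<open>Two distinct poles on the torus: common denominator and residues\<close>

locale two_poles = kronecker_eisenstein +
  fixes p q :: complex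
  assumes generic: "q - p \<notin> \<Lambda>"
begin

abbreviation "D \<equiv> poles p q"

definition P :: "nat \<Rightarrow> nat \<Rightarrow> complex \<Rightarrow> complex" where
  "P a b z = N a (z - p) * N b (q - z)"

lemma shift_holomorphic: "(\<lambda>z. \<theta> (z - p)) holomorphic_on UNIV" "(\<lambda>z. \<theta> (q - z)) holomorphic_on UNIV"
proof -
  have "(\<theta> \<circ> (\<lambda>z. z - p)) holomorphic_on UNIV" "(\<theta> \<circ> (\<lambda>z. q - z)) holomorphic_on UNIV"
    by (rule holomorphic_on_compose_gen[of _ _ _ UNIV], auto intro!: holomorphic_intros theta_holomorphic)+
  then show "(\<lambda>z. \<theta> (z - p)) holomorphic_on UNIV" "(\<lambda>z. \<theta> (q - z)) holomorphic_on UNIV"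
    by (simp_all add: o_def)
qed

lemma P_0_0: "P 0 0 z = \<theta> (z - p) * \<theta> (q - z)"
  by (simp add: P_def N_0)

lemma P_0_0_holomorphic: "P 0 0 holomorphic_on UNIV"
  unfolding P_0_0[abs_def] by (intro holomorphic_intros shift_holomorphic)

lemma P_0_0_eq_0_iff: "P 0 0 z = 0 \<longleftrightarrow> z \<in> D"
  by (simp add: P_0_0 poles_def theta_eq_0_iff)

lemma poles_disjoint: "z - p \<in> \<Lambda> \<Longrightarrow> q - z \<notin> \<Lambda>"
  using generic lattice_add[of "z - p" \<tau> "q - z"] by auto

lemma deriv_P_0_0: "deriv (P 0 0) z = deriv \<theta> (z - p) * \<theta> (q - z) - \<theta> (z - p) * deriv \<theta> (q - z)"
proof (rule DERIV_imp_deriv)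
  have th: "(\<theta> has_field_derivative deriv \<theta> w) (at w)" for w
    using holomorphic_derivI[OF theta_holomorphic open_UNIV] by auto
  have "((\<lambda>z. \<theta> (z - p)) has_field_derivative deriv \<theta> (z - p) * 1) (at z)"
    by (rule DERIV_chain2[OF th]) (auto intro!: derivative_eq_intros)
  moreover have "((\<lambda>z. \<theta> (q - z)) has_field_derivative deriv \<theta> (q - z) * (- 1)) (at z)"
    by (rule DERIV_chain2[OF th]) (auto intro!: derivative_eq_intros)
  ultimately show "(P 0 0 has_field_derivative deriv \<theta> (z - p) * \<theta> (q - z) - \<theta> (z - p) * deriv \<theta> (q - z)) (at z)"
    unfolding P_0_0[abs_def] by (auto intro!: derivative_eq_intros)
qed

text \<open>Genericity prevents the two theta factors from vanishing together, so the common
  denominator has only simple zeros.\<close>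

lemma deriv_P_0_0_nonzero:
  assumes "z \<in> D"
  shows "deriv (P 0 0) z \<noteq> 0"
proof (cases "z - p \<in> \<Lambda>")
  case True
  then have "\<theta> (z - p) = 0" "\<theta> (q - z) \<noteq> 0" "deriv \<theta> (z - p) \<noteq> 0"
    using poles_disjoint deriv_theta_nonzero by (simp_all add: theta_eq_0_iff)
  then show ?thesis by (simp add: deriv_P_0_0)
next
  case False
  then have "q - z \<in> \<Lambda>" using assms by (simp add: poles_def)
  then have "\<theta> (q - z) = 0" "\<theta> (z - p) \<noteq> 0" "deriv \<theta> (q - z) \<noteq> 0"
    using False deriv_theta_nonzero by (simp_all add: theta_eq_0_iff)
  then show ?thesis by (simp add: deriv_P_0_0)
qed

lemma P_algebra: "P a b \<in> real_analytic_algebra"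
proof -
  have "(\<lambda>z. N a (1 * z + (- p)) * N b (- 1 * z + q)) \<in> real_analytic_algebra"
    by (intro real_analytic_algebra.mult real_analytic_algebra_affine N_algebra)
  then show ?thesis by (simp add: P_def[abs_def])
qed

text \<open>The reflected argument \<open>q - z\<close> contributes the minus sign on which the
  telescoping relies.\<close>

lemma has_dbar_P:
  "has_dbar \<tau> (P a b)
    (2 * pi * \<i> * ((if a = 0 then 0 else P (a - 1) b z) - (if b = 0 then 0 else P a (b - 1) z))) z"
proof -
  have "has_dbar \<tau> (\<lambda>z. N a (z - p)) (if a = 0 then 0 else 2 * pi * \<i> * N (a - 1) (z - p)) z"
    using has_dbar_affine[of \<tau> "N a" _ 1 z "- p", OF has_dbar_N] by (cases "a = 0") simp_all
  moreover have "has_dbar \<tau> (\<lambda>z. N b (q - z)) (- (if b = 0 then 0 else 2 * pi * \<i> * N (b - 1) (q - z))) z"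
    using has_dbar_affine[of \<tau> "N b" _ "- 1" z q, OF has_dbar_N] by (cases "b = 0") simp_all
  ultimately have "has_dbar \<tau> (P a b)
      ((if a = 0 then 0 else 2 * pi * \<i> * N (a - 1) (z - p)) * N b (q - z)
        + N a (z - p) * - (if b = 0 then 0 else 2 * pi * \<i> * N (b - 1) (q - z))) z"
    unfolding P_def[abs_def] by (rule has_dbar_mult)
  then show ?thesis
    by (rule back_subst[where P = "\<lambda>d. has_dbar \<tau> (P a b) d z"]) (simp add: P_def algebra_simps)
qed

lemma has_dbar_sum_P:
  "has_dbar \<tau> (\<lambda>z. \<Sum>i\<le>b. P (a + 1 + i) (b - i) z) (2 * pi * \<i> * P a b z) z"
proof -
  have "has_dbar \<tau> (\<lambda>z. \<Sum>i\<le>b. P (a + 1 + i) (b - i) z)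
      (\<Sum>i\<le>b. 2 * pi * \<i> * (P (a + i) (b - i) z - (if b - i = 0 then 0 else P (a + 1 + i) (b - i - 1) z))) z"
  proof (rule has_dbar_sum)
    fix i
    show "has_dbar \<tau> (P (a + 1 + i) (b - i))
      (2 * pi * \<i> * (P (a + i) (b - i) z - (if b - i = 0 then 0 else P (a + 1 + i) (b - i - 1) z))) z"
      using has_dbar_P[of "a + 1 + i" "b - i" z] by simp
  qed
  moreover have "(\<Sum>i\<le>b. P (a + i) (b - i) z - (if b - i = 0 then 0 else P (a + 1 + i) (b - i - 1) z)) = P a b z"
  proof -
    \<comment> \<open>The cut-off beyond \<open>b\<close> encodes that lowering a second index 0
      gives 0, so the sum telescopes to \<open>u 0\<close> alone.\<close>
    define u where "u i = (if i \<le> b then P (a + i) (b - i) z else 0)" for i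
    have "(\<Sum>i\<le>b. P (a + i) (b - i) z - (if b - i = 0 then 0 else P (a + 1 + i) (b - i - 1) z))
        = (\<Sum>i\<le>b. u i - u (Suc i))"
      by (intro sum.cong) (auto simp: u_def)
    also have "\<dots> = u 0 - u (Suc b)" by (rule sum_telescope)
    finally show ?thesis by (simp add: u_def)
  qed
  ultimately show ?thesis by (simp flip: sum_distrib_left)
qed

lemma E_E_eq: "z \<notin> D \<Longrightarrow> E a (z - p) * E b (q - z) = P a b z / P 0 0 z"
  by (simp add: poles_def E_eq_N_over_theta P_def N_0)

lemma D_invariant:
  assumes "l \<in> \<Lambda>"
  shows "z + l \<in> D \<longleftrightarrow> z \<in> D"
proof -
  have "z + l - p = (z - p) + l" "q - (z + l) = (q - z) + (- l)" by simp_all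
  then show ?thesis using assms unfolding poles_def mem_Collect_eq by (metis lattice_add_iff lattice_minus_iff)
qed

lemma E_E_periodic:
  assumes "l \<in> \<Lambda>"
  shows "E a (z + l - p) * E b (q - (z + l)) = E a (z - p) * E b (q - z)"
proof -
  have "z + l - p = (z - p) + l" "q - (z + l) = (q - z) + (- l)" by simp_all
  then show ?thesis using assms by (metis E_periodic lattice_minus_iff)
qed

lemma finite_on_torus_D: "finite_on_torus \<tau> D"
proof -
  obtain p' q' where "D \<inter> fundamental_cell \<tau> = {p', q'}"
    using finite_on_torus_two_translates[OF Im_tau] unfolding poles_def by metis
  then show ?thesis by (simp add: finite_on_torus_def D_invariant)
qed

text \<open>One global representation serves at every point: numerator \<open>K * P a b\<close>,
  denominator \<open>P 0 0\<close>, exponent 1.\<close>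

lemma smooth_holo_poles_E_E:
  "smooth_holo_poles \<tau> D (\<lambda>z. K * (E a (z - p) * E b (q - z)))"
  unfolding smooth_holo_poles_def
proof (intro conjI allI impI ballI)
  show "finite_on_torus \<tau> D" by (rule finite_on_torus_D)
  show "K * (E a (z + l - p) * E b (q - (z + l))) = K * (E a (z - p) * E b (q - z))" if "l \<in> \<Lambda>" for z l
    using E_E_periodic[OF that] by simp
  fix w
  have "smooth_on UNIV (\<lambda>z. K * P a b z)"
    by (intro smooth_on_real_analytic_algebra real_analytic_algebra.mult P_algebra real_analytic_algebra_const)
  then show "\<exists>U g h k. open U \<and> w \<in> U \<and> smooth_on U g \<and> h holomorphic_on U \<and>
      (\<forall>z\<in>U. h z = 0 \<longleftrightarrow> z \<in> D) \<and> (\<forall>z\<in>U \<inter> D. deriv h z \<noteq> 0) \<and>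
      (\<forall>z\<in>U - D. K * (E a (z - p) * E b (q - z)) = g z / h z ^ k)"
    using P_0_0_holomorphic P_0_0_eq_0_iff deriv_P_0_0_nonzero E_E_eq
    by (intro exI[of _ UNIV] exI[of _ "\<lambda>z. K * P a b z"] exI[of _ "P 0 0"] exI[of _ 1]) auto
qed

lemma has_holo_residue_E_E:
  "has_holo_residue \<tau> D (\<lambda>z. K * (E a (z - p) * E b (q - z))) (K * residue_value a b (q - p))"
proof -
  let ?f = "\<lambda>z. K * (E a (z - p) * E b (q - z))"
  obtain p' q' where p': "p' - p \<in> \<Lambda>" and q': "q' - q \<in> \<Lambda>"
    and cell: "D \<inter> fundamental_cell \<tau> = {p', q'}"
    using finite_on_torus_two_translates[OF Im_tau] unfolding poles_def by metis
  have flip: "q - z \<in> \<Lambda> \<longleftrightarrow> z - q \<in> \<Lambda>" for z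
    using lattice_minus_iff[of "z - q" \<tau>] by simp
  have "p' \<noteq> q'" using poles_disjoint[of p'] p' q' by (auto simp: flip)
  \<comment> \<open>The poles inside the cell are only translates of \<open>p\<close> and
    \<open>q\<close>; periodicity lets the regular factor be evaluated at \<open>q - p\<close> all
    the same.\<close>
  have Ep: "E b (q - p') = E b (q - p)"
    using E_periodic[OF lattice_minus[OF p'], of b "q - p"] by simp
  have Eq: "E a (q' - p) = E a (q - p)"
    using E_periodic[OF q', of a "q - p"] by simp
  have cont: "continuous_on (- D) ?f"
    by (intro continuous_intros continuous_on_compose2[OF E_continuous]) (auto simp: poles_def)
  have iso: "\<exists>r>0. ball w r - {w} \<subseteq> - D" for w
  proof -
    have "\<forall>\<^sub>F z in at w. P 0 0 z \<noteq> 0"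
      using P_0_0_holomorphic deriv_P_0_0_nonzero
      by (intro eventually_nonzero_at_simple_zeros) (auto simp: P_0_0_eq_0_iff)
    then show ?thesis
      unfolding eventually_at P_0_0_eq_0_iff by (auto simp: subset_iff dist_commute)
  qed
  have limp: "((\<lambda>z. (z - p') * ?f z) \<longlongrightarrow> K * (of_bool (a = 1) * E b (q - p))) (at p')"
  proof -
    have "((\<lambda>z. (z - (p' - p)) * E a z) \<longlongrightarrow> of_bool (a = 1)) (at (p' - p))"
      by (rule E_lattice_limit[OF p'])
    then have *: "((\<lambda>z. (z - p') * E a (z - p)) \<longlongrightarrow> of_bool (a = 1)) (at p')"
      using LIM_offset[of "\<lambda>z. (z - (p' - p)) * E a z" _ "p' - p" "- p"] by (simp add: algebra_simps)
    have "isCont (\<lambda>z. E b (q - z)) p'"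
    proof -
      have "isCont (E b) (q - p')"
        using E_continuous[of b] poles_disjoint[OF p'] by (simp add: continuous_on_eq_continuous_at open_compl_lattice)
      then show ?thesis using isCont_o2[of p' "\<lambda>z. q - z" "E b"] by simp
    qed
    then have "((\<lambda>z. E b (q - z)) \<longlongrightarrow> E b (q - p)) (at p')" using Ep by (simp add: isCont_def)
    from tendsto_mult[OF tendsto_const[of K] tendsto_mult[OF * this]] show ?thesis by (simp add: mult_ac)
  qed
  have limq: "((\<lambda>z. (z - q') * ?f z) \<longlongrightarrow> K * - (of_bool (b = 1) * E a (q - p))) (at q')"
  proof -
    have q'': "q - q' \<in> \<Lambda>" using q' by (simp add: flip)
    have lim1: "((\<lambda>z. (z - (q - q')) * E b z) \<longlongrightarrow> of_bool (b = 1)) (at (q - q'))"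
      by (rule E_lattice_limit[OF q''])
    have "filterlim (\<lambda>z. q - z) (at (q - q')) (at q')"
      by (intro filterlim_atI tendsto_intros) (auto simp: eventually_at_filter)
    from filterlim_compose[OF lim1 this]
    have *: "((\<lambda>z. (q' - z) * E b (q - z)) \<longlongrightarrow> of_bool (b = 1)) (at q')" by simp
    have "isCont (\<lambda>z. E a (z - p)) q'"
    proof -
      have "q' - p \<notin> \<Lambda>" using poles_disjoint[of q'] q'' by auto
      then have "isCont (E a) (q' - p)"
        using E_continuous[of a] by (simp add: continuous_on_eq_continuous_at open_compl_lattice)
      then show ?thesis using isCont_o2[of q' "\<lambda>z. z - p" "E a"] by simp
    qed
    then have "((\<lambda>z. E a (z - p)) \<longlongrightarrow> E a (q - p)) (at q')" using Eq by (simp add: isCont_def)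
    \<comment> \<open>The limit was taken with \<open>q' - z\<close> in place of
      \<open>z - q'\<close>, whence \<open>- K\<close>.\<close>
    from tendsto_mult[OF tendsto_const[of "- K"] tendsto_mult[OF * this]] show ?thesis
      by (simp add: algebra_simps)
  qed
  define L where "L w = 2 * pi * \<i> * (if w = p' then K * (of_bool (a = 1) * E b (q - p))
    else K * - (of_bool (b = 1) * E a (q - p)))" for w
  have "((\<lambda>\<epsilon>. contour_integral (circlepath w \<epsilon>) ?f) \<longlongrightarrow> L w) (at_right 0)"
    if "w \<in> D \<inter> fundamental_cell \<tau>" for w
  proof -
    obtain r where r: "r > 0" "ball w r - {w} \<subseteq> - D" using iso by blast
    show ?thesis unfolding L_def
      by (rule contour_integral_circlepath_tendsto[OF continuous_on_subset[OF cont r(2)] r(1)])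
        (use that limp limq \<open>p' \<noteq> q'\<close> in \<open>auto simp: cell\<close>)
  qed
  moreover have "K * residue_value a b (q - p) = (\<Sum>w\<in>D \<inter> fundamental_cell \<tau>. 1 / (2 * pi * \<i>) * L w)"
    using \<open>p' \<noteq> q'\<close> by (simp add: cell L_def residue_value_def algebra_simps)
  ultimately show ?thesis
    unfolding has_holo_residue_def using smooth_holo_poles_E_E by blast
qed

end

section \<open>The regularized integral of a product with two poles\<close>

lemma emeasure_fundamental_cell:
  assumes "Im \<tau> > 0"
  shows "emeasure lborel (fundamental_cell \<tau>) = ennreal (Im \<tau>)"
proof -
  let ?\<phi> = "\<lambda>(x, y). of_real x + of_real y * \<tau>"
  have [measurable]: "?\<phi> \<in> borel_measurable (lborel \<Otimes>\<^sub>M lborel)" by measurable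
  note [measurable] = fundamental_cell_borel[OF assms]
  have "?\<phi> -` fundamental_cell \<tau> = {0..<1} \<times> {0..<1}"
    using mem_fundamental_cell_iff[OF assms] by auto
  then have "emeasure (distr (lborel \<Otimes>\<^sub>M lborel) borel ?\<phi>) (fundamental_cell \<tau>) = 1"
    by (simp add: emeasure_distr space_pair_measure lborel.emeasure_pair_measure_Times)
  then show ?thesis
    by (subst lborel_complex_eq_skew_coordinates[OF assms]) (simp add: emeasure_density_const)
qed

text \<open>For an absolutely integrable function the regularized integral is the ordinary one, by
  dominated convergence: \<open>D\<close> is null and closed, so almost every point leaves all the
  balls once their radius is small.\<close>

lemma tendsto_integral_minus_balls:
  fixes f :: "complex \<Rightarrow> complex"
  assumes D: "closed D" "countable D" and S: "S \<in> sets borel" and int: "set_integrable lborel S f"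
  shows "((\<lambda>\<epsilon>. LINT z:S - (\<Union>p\<in>D. ball p \<epsilon>)|lborel. f z) \<longlongrightarrow> (LINT z:S|lborel. f z)) (at_right 0)"
  unfolding tendsto_at_iff_sequentially
proof (intro allI impI)
  fix X :: "nat \<Rightarrow> real"
  assume X: "\<forall>i. X i \<in> {0<..} - {0}" "X \<longlonglongrightarrow> 0"
  let ?g = "\<lambda>z. indicator S z *\<^sub>R f z"
  have "(\<lambda>i. \<integral>z. indicator (S - (\<Union>p\<in>D. ball p (X i))) z *\<^sub>R f z \<partial>lborel) \<longlonglongrightarrow> (\<integral>z. ?g z \<partial>lborel)"
  proof (rule integral_dominated_convergence)
    show "?g \<in> borel_measurable lborel"
      using int by (simp add: set_integrable_def borel_measurable_integrable)
    show "(\<lambda>z. indicator (S - (\<Union>p\<in>D. ball p (X i))) z *\<^sub>R f z) \<in> borel_measurable lborel" for i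
    proof -
      have "set_integrable lborel (S - (\<Union>p\<in>D. ball p (X i))) f"
      proof (rule set_integrable_subset[OF int])
        have "open (\<Union>p\<in>D. ball p (X i))" by auto
        then show "S - (\<Union>p\<in>D. ball p (X i)) \<in> sets lborel" using S by (simp add: sets.Diff)
      qed auto
      then show ?thesis by (simp add: set_integrable_def borel_measurable_integrable)
    qed
    show "integrable lborel (\<lambda>z. norm (?g z))"
      using int unfolding set_integrable_def by (rule integrable_norm)
    show "AE z in lborel. norm (indicator (S - (\<Union>p\<in>D. ball p (X i))) z *\<^sub>R f z) \<le> norm (?g z)" for i
      by (auto split: split_indicator)
    have "AE z in lborel. z \<notin> D"
      using D(2) by (intro AE_not_in countable_imp_null_set_lborel)
    then show "AE z in lborel. (\<lambda>i. indicator (S - (\<Union>p\<in>D. ball p (X i))) z *\<^sub>R f z) \<longlonglongrightarrow> ?g z"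
    proof eventually_elim
      case (elim z)
      obtain r where r: "r > 0" "ball z r \<subseteq> - D"
        using D(1) elim by (meson ComplI open_Compl open_contains_ball)
      have "\<forall>\<^sub>F i in sequentially. X i < r"
        using order_tendstoD(2)[OF X(2) r(1)] .
      then have "\<forall>\<^sub>F i in sequentially. indicator (S - (\<Union>p\<in>D. ball p (X i))) z *\<^sub>R f z = ?g z"
      proof eventually_elim
        case (elim i)
        have "z \<notin> ball p (X i)" if "p \<in> D" for p
          using r(2) that elim by (auto simp: subset_iff dist_commute)
        then show ?case by (auto split: split_indicator)
      qed
      then show ?case by (rule tendsto_eventually)
    qed
  qed
  then show "((\<lambda>\<epsilon>. LINT z:S - (\<Union>p\<in>D. ball p \<epsilon>)|lborel. f z) \<circ> X) \<longlonglongrightarrow> (LINT z:S|lborel. f z)"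
    by (simp add: o_def set_lebesgue_integral_def)
qed

context two_poles
begin

lemma countable_D: "countable D"
proof -
  have "D \<subseteq> (\<lambda>l. l + p) ` \<Lambda> \<union> (\<lambda>l. q - l) ` \<Lambda>"
  proof
    fix z assume "z \<in> D"
    then consider "z - p \<in> \<Lambda>" | "q - z \<in> \<Lambda>" by (auto simp: poles_def)
    then show "z \<in> (\<lambda>l. l + p) ` \<Lambda> \<union> (\<lambda>l. q - l) ` \<Lambda>"
      by cases (force intro: image_eqI[of _ _ "z - p"] image_eqI[of _ _ "q - z"])+
  qed
  then show ?thesis
    by (rule countable_subset) (simp add: countable_lattice)
qed

lemma closed_D: "closed D"
proof -
  have "D = P 0 0 -` {0}" using P_0_0_eq_0_iff by auto
  then show ?thesis
    using holomorphic_on_imp_continuous_on[OF P_0_0_holomorphic] closed_vimage[of "{0}" "P 0 0"] by simp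
qed

(* The last two terms are multiples of e_1 over the common denominator; they cancel the residues of
   the telescoping sum, so that the numerator vanishes at both poles (primitive_eq_0). *)
definition primitive :: "nat \<Rightarrow> nat \<Rightarrow> complex \<Rightarrow> complex" where
  "primitive a b z = (\<Sum>i\<le>b. P (a + 1 + i) (b - i) z)
     + (- (of_bool (a = 0) * E b (q - p))) * P 1 0 z + (- (of_bool (b \<noteq> 0) * E (a + b) (q - p))) * P 0 1 z"

lemma has_dbar_primitive:
  "has_dbar \<tau> (primitive a b) (2 * pi * \<i> * (P a b z - integral_value a b (q - p) * P 0 0 z)) z"
proof -
  have "has_dbar \<tau> (P 1 0) (2 * pi * \<i> * P 0 0 z) z" "has_dbar \<tau> (P 0 1) (- (2 * pi * \<i> * P 0 0 z)) z"
    using has_dbar_P[of 1 0 z] has_dbar_P[of 0 1 z] by simp_all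
  from has_dbar_add[OF has_dbar_add[OF has_dbar_sum_P has_dbar_cmult[OF this(1)]] has_dbar_cmult[OF this(2)]]
  show ?thesis
    unfolding primitive_def[abs_def]
    by (rule back_subst[where P = "\<lambda>d. has_dbar \<tau> _ d z"]) (simp add: integral_value_def algebra_simps)
qed

lemma primitive_eq_0:
  assumes "z \<in> D"
  shows "primitive a b z = 0"
proof -
  \<comment> \<open>At a pole of one factor the argument of the other is congruent to
    \<open>q - p\<close>, so its numerator is a known value times \<theta>.\<close>
  have N_E: "N k w = E k (q - p) * \<theta> w" if "w - (q - p) \<in> \<Lambda>" for k w
  proof -
    have "w \<notin> \<Lambda>" using generic lattice_diff[OF _ that, of w] by auto
    then show ?thesis
      using E_periodic[OF that, of k "q - p"] theta_eq_0_iff[of w]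
      by (simp add: E_eq_N_over_theta[of w] field_simps)
  qed
  consider "z - p \<in> \<Lambda>" | "q - z \<in> \<Lambda>" using assms by (auto simp: poles_def)
  then show ?thesis
  proof cases
    case 1
    have "(q - z) - (q - p) = - (z - p)" by simp
    with 1 have w: "(q - z) - (q - p) \<in> \<Lambda>" by (simp only: lattice_minus_iff)
    have P: "P k j z = of_bool (k = 1) * deriv \<theta> (z - p) * (E j (q - p) * \<theta> (q - z))" for k j
      unfolding P_def N_lattice[OF 1] N_E[OF w] by simp
    \<comment> \<open>Over \<open>p\<close> only first index 1 survives, so only
      \<open>i = 0\<close>; the matching correction is \<open>P 1 0\<close>, evaluated with
      \<open>E 0 (q - p) = 1\<close>.\<close>
    have "(\<Sum>i\<le>b. P (a + 1 + i) (b - i) z) = (\<Sum>i\<le>b. if i = 0 then P (a + 1) b z else 0)"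
      by (intro sum.cong) (auto simp: P)
    then show ?thesis using E_0[OF generic] by (simp add: primitive_def P)
  next
    case 2
    have "(z - p) - (q - p) = - (q - z)" by simp
    with 2 have w: "(z - p) - (q - p) \<in> \<Lambda>" by (simp only: lattice_minus_iff)
    have P: "P k j z = E k (q - p) * \<theta> (z - p) * (of_bool (j = 1) * deriv \<theta> (q - z))" for k j
      unfolding P_def N_lattice[OF 2] N_E[OF w] by simp
    \<comment> \<open>Over \<open>q\<close> the second index must be 1, so \<open>i = b - 1\<close>.
      For \<open>b = 0\<close> truncated subtraction would select \<open>i = 0\<close>, which the
      factor \<open>of_bool (b \<noteq> 0)\<close> suppresses.\<close>
    have "(\<Sum>i\<le>b. P (a + 1 + i) (b - i) z) = (\<Sum>i\<le>b. if i = b - 1 then of_bool (b \<noteq> 0) * P (a + b) 1 z else 0)"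
      by (intro sum.cong) (auto simp: P)
    then show ?thesis using E_0[OF generic] by (simp add: primitive_def P)
  qed
qed

lemma primitive_algebra: "primitive a b \<in> real_analytic_algebra"
proof -
  have "(\<lambda>z. \<Sum>i\<le>b. P (a + 1 + i) (b - i) z) \<in> real_analytic_algebra"
    by (rule real_analytic_algebra_sum) (rule P_algebra)
  moreover have "(\<lambda>z. k * P i j z) \<in> real_analytic_algebra" for k i j
    by (rule real_analytic_algebra.mult[OF real_analytic_algebra_const P_algebra])
  ultimately show ?thesis
    unfolding primitive_def[abs_def] by (intro real_analytic_algebra.add)
qed

lemma primitive_periodic:
  assumes "z \<notin> D" "l \<in> \<Lambda>"
  shows "primitive a b (z + l) / P 0 0 (z + l) = primitive a b z / P 0 0 z"
proof -
  have "P i j (z + l) / P 0 0 (z + l) = P i j z / P 0 0 z" for i j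
    using E_E_eq[OF assms(1), of i j] E_E_eq[of "z + l" i j] E_E_periodic[OF assms(2), of i z j]
      D_invariant[OF assms(2), of z] assms(1) by simp
  then show ?thesis
    unfolding primitive_def add_divide_distrib sum_divide_distrib times_divide_eq_right[symmetric] by simp
qed

text \<open>The product is its mean value plus the image of a periodic bounded function under the
  operator divided by \<open>2 * pi * \<i>\<close>. The latter integrates to 0, and the cell has
  area \<open>Im \<tau>\<close>.\<close>

lemma
  shows set_integrable_E_E: "set_integrable lborel (fundamental_cell \<tau>) (\<lambda>z. K * (E a (z - p) * E b (q - z)))"
    and integral_E_E: "(LINT z:fundamental_cell \<tau>|lborel. K * (E a (z - p) * E b (q - z)))
      = K * integral_value a b (q - p) * of_real (Im \<tau>)"
proof -
  let ?V = "integral_value a b (q - p)" and ?cell = "fundamental_cell \<tau>"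
  let ?d = "\<lambda>z. 2 * pi * \<i> * (P a b z - ?V * P 0 0 z)"
  \<comment> \<open>This function equals the product off the null set \<open>D\<close>, so
    integrability and the value of the integral carry over almost everywhere.\<close>
  define g where "g z = ?d z / P 0 0 z / (2 * pi * \<i>) + ?V" for z
  note dbar = integral_cell_dbar_eq_0[OF Im_tau P_0_0_holomorphic countable_D P_0_0_eq_0_iff
      deriv_P_0_0_nonzero primitive_algebra primitive_eq_0 primitive_periodic has_dbar_primitive, of a b]
  have int1: "set_integrable lborel ?cell (\<lambda>z. ?d z / P 0 0 z / (2 * pi * \<i>))"
    using dbar(1) by (intro set_integrable_divide) auto
  have int2: "set_integrable lborel ?cell (\<lambda>z. ?V)"
    using emeasure_fundamental_cell[OF Im_tau] fundamental_cell_borel[OF Im_tau]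
    by (simp add: set_integrable_def)
  have int: "set_integrable lborel ?cell (\<lambda>z. K * g z)"
    unfolding g_def[abs_def] by (intro set_integrable_mult_right set_integral_add(1) int1 int2)
  have "(LINT z:?cell|lborel. g z) = (LINT z:?cell|lborel. ?d z / P 0 0 z / (2 * pi * \<i>)) + (LINT z:?cell|lborel. ?V)"
    unfolding g_def[abs_def] by (rule set_integral_add(2)[OF int1 int2])
  also have "(LINT z:?cell|lborel. ?d z / P 0 0 z / (2 * pi * \<i>)) = 0"
    using dbar(2) by (subst set_integral_divide_zero) simp
  also have "(LINT z:?cell|lborel. ?V) = of_real (Im \<tau>) * ?V"
    using emeasure_fundamental_cell[OF Im_tau] fundamental_cell_borel[OF Im_tau] Im_tau
    by (simp add: set_lebesgue_integral_def measure_def scaleR_conv_of_real)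
  finally have int_g: "(LINT z:?cell|lborel. K * g z) = K * ?V * of_real (Im \<tau>)"
    by simp
  have g_eq: "K * g z = K * (E a (z - p) * E b (q - z))" if "z \<notin> D" for z
    using that P_0_0_eq_0_iff[of z] by (simp add: g_def E_E_eq diff_divide_distrib)
  have AE: "AE z in lborel. z \<notin> D"
    by (intro AE_not_in countable_imp_null_set_lborel countable_D)
  have meas_g: "(\<lambda>z. K * g z) \<in> borel_measurable borel"
  proof -
    have [measurable]: "P i j \<in> borel_measurable borel" for i j
      by (rule borel_measurable_continuous_onI[OF real_analytic_algebra_continuous[OF P_algebra]])
    show ?thesis unfolding g_def by measurable
  qed
  have meas: "(\<lambda>z. K * (E a (z - p) * E b (q - z))) \<in> borel_measurable borel"
  proof (rule borel_measurable_continuous_countable_exceptions[OF countable_D])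
    show "continuous_on (- D) (\<lambda>z. K * (E a (z - p) * E b (q - z)))"
      by (intro continuous_intros continuous_on_compose2[OF E_continuous]) (auto simp: poles_def)
  qed
  have cell: "?cell \<in> sets lborel" using fundamental_cell_borel[OF Im_tau] by simp
  have eq: "AE z in lborel. indicator ?cell z *\<^sub>R (K * g z) = indicator ?cell z *\<^sub>R (K * (E a (z - p) * E b (q - z)))"
    using AE by eventually_elim (simp add: g_eq)
  have meas': "(\<lambda>z. indicator ?cell z *\<^sub>R (K * g z)) \<in> borel_measurable lborel"
    "(\<lambda>z. indicator ?cell z *\<^sub>R (K * (E a (z - p) * E b (q - z)))) \<in> borel_measurable lborel"
    using cell meas meas_g by (auto intro!: borel_measurable_scaleR borel_measurable_indicator)
  show "set_integrable lborel ?cell (\<lambda>z. K * (E a (z - p) * E b (q - z)))"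
    using int integrable_cong_AE[OF meas' eq] by (simp add: set_integrable_def)
  show "(LINT z:?cell|lborel. K * (E a (z - p) * E b (q - z))) = K * ?V * of_real (Im \<tau>)"
    using int_g unfolding set_lebesgue_integral_def integral_cong_AE[OF meas' eq] .
qed

lemma has_reg_integral_E_E:
  "has_reg_integral \<tau> D (\<lambda>z. K * (E a (z - p) * E b (q - z))) (K * integral_value a b (q - p))"
  unfolding has_reg_integral_def
proof
  show "smooth_holo_poles \<tau> D (\<lambda>z. K * (E a (z - p) * E b (q - z)))"
    by (rule smooth_holo_poles_E_E)
  have "((\<lambda>\<epsilon>. (LINT z:fundamental_cell \<tau> - (\<Union>p\<in>D. ball p \<epsilon>)|lborel. K * (E a (z - p) * E b (q - z))) / of_real (Im \<tau>))
      \<longlongrightarrow> (K * integral_value a b (q - p) * of_real (Im \<tau>)) / of_real (Im \<tau>)) (at_right 0)"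
    unfolding integral_E_E[symmetric] using Im_tau
    by (intro tendsto_divide tendsto_const tendsto_integral_minus_balls closed_D countable_D
        fundamental_cell_borel set_integrable_E_E) auto
  then show "((\<lambda>\<epsilon>. (LINT z:fundamental_cell \<tau> - (\<Union>p\<in>D. ball p \<epsilon>)|lborel. K * (E a (z - p) * E b (q - z))) / of_real (Im \<tau>))
      \<longlongrightarrow> K * integral_value a b (q - p)) (at_right 0)"
    using Im_tau by simp
qed

end

section \<open>Iteration\<close>

lemma sum_s_var:
  assumes "n \<ge> 1"
  shows "(\<Sum>k=1..n. s_var n c z k) = (\<Sum>k=1..n. c k)"
proof -
  obtain N where n: "n = Suc N" using assms by (cases n) auto
  have "(\<Sum>k=1..N. s_var n c z k) = (\<Sum>k=1..N. c k) + (\<Sum>k=1..N. z k - z (k + 1))"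
    unfolding sum.distrib[symmetric] by (intro sum.cong) (auto simp: s_var_def n)
  moreover have "(\<Sum>k=1..N. z k - z (k + 1)) = z 1 - z (Suc N)"
    by (induction N) auto
  ultimately show ?thesis by (simp add: n s_var_def)
qed

text \<open>Supplies a concrete generic offset for the auxiliary pole of a factor
  \<open>E 0\<close>.\<close>

lemma half_not_in_lattice:
  assumes "Im \<tau> > 0"
  shows "1 / 2 \<notin> lattice \<tau>"
proof
  assume "1 / 2 \<in> lattice \<tau>"
  then obtain a b where "of_real (1 / 2) + of_real 0 * \<tau> = of_real (of_int a) + of_real (of_int b) * \<tau>"
    by (auto simp: lattice_def)
  from skew_coordinates_inject(1)[OF assms this] have "real_of_int 1 = real_of_int (2 * a)" by simp
  then have "1 = 2 * a" by linarith
  then show False by presburger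
qed

section \<open>Chains and loops under an abstract one-variable operation\<close>

context kronecker_eisenstein
begin

text \<open>Once the earlier variables are eliminated, the next one occurs in a single factor, which
  the operation replaces by the constant \<open>\<delta>\<close>. Keeping \<open>R\<close> abstract
  serves residues and integrals alike.\<close>

lemma has_iterated_chain_partial:
  assumes single: "\<And>p a K. \<exists>D G. R D G (K * \<delta> a) \<and> (\<forall>w. w \<notin> D \<longrightarrow> G w = K * E a (w - p))"
    and "k \<le> n - 1"
  shows "has_iterated R k (xi_chain \<tau> \<theta> n m c z0) z
    ((\<Prod>j=1..k. \<delta> (m j)) * ((\<Prod>j=k+1..n-1. E (m j) (s_var n c z j)) * E (m n) (z n - z0)))"
  using \<open>k \<le> n - 1\<close>
proof (induction k arbitrary: z)
  case 0
  then show ?case by (simp add: xi_chain_def)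
next
  case (Suc k)
  define K where "K = (\<Prod>j=1..k. \<delta> (m j)) * ((\<Prod>j=k+2..n-1. E (m j) (s_var n c z j)) * E (m n) (z n - z0))"
  obtain D G where R: "R D G (K * \<delta> (m (k + 1)))"
    and G: "\<And>w. w \<notin> D \<Longrightarrow> G w = K * E (m (k + 1)) (w - (z (k + 2) - c (k + 1)))"
    using single by blast
  have "has_iterated R k (xi_chain \<tau> \<theta> n m c z0) (z(Suc k := w)) (G w)" if "w \<notin> D" for w
  proof -
    let ?z = "z(Suc k := w)"
    have "(\<Prod>j=k+2..n-1. E (m j) (s_var n c ?z j)) = (\<Prod>j=k+2..n-1. E (m j) (s_var n c z j))"
      using Suc.prems by (intro prod.cong) (auto simp: s_var_def)
    moreover have "s_var n c ?z (k + 1) = w - (z (k + 2) - c (k + 1))"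
      using Suc.prems by (auto simp: s_var_def)
    moreover have "{k+1..n-1} = insert (k + 1) {k+2..n-1}" using Suc.prems by auto
    moreover have "?z n = z n" using Suc.prems by auto
    ultimately have "(\<Prod>j=1..k. \<delta> (m j)) * ((\<Prod>j=k+1..n-1. E (m j) (s_var n c ?z j)) * E (m n) (?z n - z0)) = G w"
      using G[OF that] by (simp add: K_def mult_ac del: fun_upd_apply)
    then show ?thesis using Suc.IH[of ?z] Suc.prems by (simp del: fun_upd_apply)
  qed
  with R show ?case by (auto simp: K_def mult_ac)
qed

lemma has_iterated_chain:
  assumes single: "\<And>p a K. \<exists>D G. R D G (K * \<delta> a) \<and> (\<forall>w. w \<notin> D \<longrightarrow> G w = K * E a (w - p))"
    and "n \<ge> 1"
  shows "has_iterated R n (xi_chain \<tau> \<theta> n m c z0) z (\<Prod>k=1..n. \<delta> (m k))"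
proof -
  obtain N where n: "n = Suc N" using \<open>n \<ge> 1\<close> by (cases n) auto
  obtain D G where R: "R D G ((\<Prod>j=1..N. \<delta> (m j)) * \<delta> (m n))"
    and G: "\<And>w. w \<notin> D \<Longrightarrow> G w = (\<Prod>j=1..N. \<delta> (m j)) * E (m n) (w - z0)"
    using single by blast
  have "has_iterated R N (xi_chain \<tau> \<theta> n m c z0) (z(n := w)) (G w)" if "w \<notin> D" for w
    using has_iterated_chain_partial[OF single, of N n m c z0 "z(n := w)"] G[OF that] by (simp add: n)
  moreover have "(\<Prod>k=1..n. \<delta> (m k)) = (\<Prod>j=1..N. \<delta> (m j)) * \<delta> (m n)" by (simp add: n)
  ultimately show ?thesis using R unfolding n has_iterated.simps by metis
qed

text \<open>Eliminating a variable fuses the two factors that contain it into one, with index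
  \<open>M k\<close> and accumulated scalar \<open>\<alpha> k\<close>; its argument telescopes to a
  sum of constants plus \<open>z n - z (k + 1)\<close>. The fused value is meaningful only off the
  lattice, hence the genericity premise for \<open>k > 0\<close>.\<close>

lemma has_iterated_loop_partial:
  assumes R: "\<And>p q a b K. q - p \<notin> \<Lambda> \<Longrightarrow>
      R (poles p q) (\<lambda>z. K * (E a (z - p) * E b (q - z))) (K * V a b (q - p))"
    and init: "\<alpha> 0 = 1" "M 0 = m n"
    and rec: "\<And>k w. k + 1 < n \<Longrightarrow> w \<notin> \<Lambda> \<Longrightarrow> \<alpha> k * V (m (k + 1)) (M k) w = \<alpha> (k + 1) * E (M (k + 1)) w"
    and "k < n" and "k > 0 \<Longrightarrow> c n + (\<Sum>j=1..k. c j) + z n - z (k + 1) \<notin> \<Lambda>"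
  shows "has_iterated R k (xi_loop \<tau> \<theta> n m c) z
    (\<alpha> k * (E (M k) (c n + (\<Sum>j=1..k. c j) + z n - z (k + 1)) * (\<Prod>j=k+1..n-1. E (m j) (s_var n c z j))))"
  using assms(5,6)
proof (induction k arbitrary: z)
  case 0
  then obtain N where n: "n = Suc N" by (cases n) auto
  show ?case by (simp add: xi_loop_def init n s_var_def)
next
  case (Suc k)
  define p where "p = z (k + 2) - c (k + 1)"
  define q where "q = c n + (\<Sum>j=1..k. c j) + z n"
  define K where "K = \<alpha> k * (\<Prod>j=k+2..n-1. E (m j) (s_var n c z j))"
  have qp: "q - p = c n + (\<Sum>j=1..Suc k. c j) + z n - z (Suc k + 1)"
    by (simp add: p_def q_def)
  have generic: "q - p \<notin> \<Lambda>" using Suc.prems unfolding qp by simp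
  have "has_iterated R k (xi_loop \<tau> \<theta> n m c) (z(Suc k := w))
      (K * (E (m (k + 1)) (w - p) * E (M k) (q - w)))" if "w \<notin> poles p q" for w
  proof -
    let ?z = "z(Suc k := w)"
    have "(\<Prod>j=k+2..n-1. E (m j) (s_var n c ?z j)) = (\<Prod>j=k+2..n-1. E (m j) (s_var n c z j))"
      using Suc.prems by (intro prod.cong) (auto simp: s_var_def)
    moreover have "s_var n c ?z (k + 1) = w - p"
      using Suc.prems by (auto simp: s_var_def p_def)
    moreover have "{k+1..n-1} = insert (k + 1) {k+2..n-1}" using Suc.prems by auto
    moreover have "c n + (\<Sum>j=1..k. c j) + ?z n - ?z (k + 1) = q - w"
      using Suc.prems by (simp add: q_def)
    ultimately have "\<alpha> k * (E (M k) (c n + (\<Sum>j=1..k. c j) + ?z n - ?z (k + 1)) *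
        (\<Prod>j=k+1..n-1. E (m j) (s_var n c ?z j))) = K * (E (m (k + 1)) (w - p) * E (M k) (q - w))"
      by (simp add: K_def mult_ac del: fun_upd_apply)
    \<comment> \<open>Being off the poles in \<open>w\<close> is precisely the genericity that the
      previous stage demands, so no further points have to be disregarded.\<close>
    moreover have "c n + (\<Sum>j=1..k. c j) + ?z n - ?z (k + 1) \<notin> \<Lambda>"
      using that \<open>c n + _ + _ - _ = q - w\<close> by (simp add: poles_def del: fun_upd_apply)
    ultimately show ?thesis
      using Suc.IH[of ?z] Suc.prems by (simp del: fun_upd_apply)
  qed
  moreover have "R (poles p q) (\<lambda>w. K * (E (m (k + 1)) (w - p) * E (M k) (q - w))) (K * V (m (k + 1)) (M k) (q - p))"
    by (rule R[OF generic])
  moreover have "K * V (m (k + 1)) (M k) (q - p)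
      = \<alpha> (Suc k) * (E (M (Suc k)) (q - p) * (\<Prod>j=Suc k+1..n-1. E (m j) (s_var n c z j)))"
    using rec[of k "q - p"] generic Suc.prems by (simp add: K_def mult_ac)
  ultimately show ?case unfolding qp[symmetric] by (auto simp del: of_nat_Suc)
qed

text \<open>In the last stage the integrand is constant, and it is treated as a multiple of
  \<open>E 0 * E 0\<close> with auxiliary poles at 0 and \<open>1 / 2\<close>. The number \<epsilon>
  is the value of the operation on the constant 1: 0 for residues, 1 for integrals.\<close>

lemma has_iterated_loop:
  assumes R: "\<And>p q a b K. q - p \<notin> \<Lambda> \<Longrightarrow>
      R (poles p q) (\<lambda>z. K * (E a (z - p) * E b (q - z))) (K * V a b (q - p))"
    and V: "\<And>w. w \<notin> \<Lambda> \<Longrightarrow> V 0 0 w = \<epsilon>"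
    and init: "\<alpha> 0 = 1" "M 0 = m n"
    and rec: "\<And>k w. k + 1 < n \<Longrightarrow> w \<notin> \<Lambda> \<Longrightarrow> \<alpha> k * V (m (k + 1)) (M k) w = \<alpha> (k + 1) * E (M (k + 1)) w"
    and n: "n \<ge> 2" and generic: "(\<Sum>k=1..n. c k) \<notin> \<Lambda>"
  shows "has_iterated R n (xi_loop \<tau> \<theta> n m c) z (\<alpha> (n - 1) * E (M (n - 1)) (\<Sum>k=1..n. c k) * \<epsilon>)"
proof -
  obtain N where N: "n = Suc N" "N > 0" using n by (cases n) auto
  define K where "K = \<alpha> N * E (M N) (\<Sum>k=1..n. c k)"
  have "has_iterated R N (xi_loop \<tau> \<theta> n m c) (z(n := w)) (K * (E 0 (w - 0) * E 0 (1 / 2 - w)))"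
    if "w \<notin> poles 0 (1 / 2)" for w
  proof -
    \<comment> \<open>Here \<open>N + 1\<close> is \<open>n\<close>, so the last variable
      cancels.\<close>
    have "c n + (\<Sum>j=1..N. c j) + (z(n := w)) n - (z(n := w)) (N + 1) = (\<Sum>k=1..n. c k)"
      by (simp add: N)
    moreover have "{N+1..n-1} = {}" by (simp add: N)
    moreover have "w - 0 \<notin> \<Lambda>" "1 / 2 - w \<notin> \<Lambda>" using that unfolding poles_def by auto
    ultimately show ?thesis
      using has_iterated_loop_partial[of R V \<alpha> M m n N c "z(n := w)", OF R init rec] generic N
      by (simp only: K_def E_0 prod.empty mult_1_right) (auto simp: E_0)
  qed
  moreover have "R (poles 0 (1 / 2)) (\<lambda>w. K * (E 0 (w - 0) * E 0 (1 / 2 - w))) (K * V 0 0 (1 / 2 - 0))"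
    using half_not_in_lattice[OF Im_tau] by (intro R) simp
  moreover have "V 0 0 (1 / 2 - 0) = \<epsilon>"
    using half_not_in_lattice[OF Im_tau] by (intro V) simp
  ultimately show ?thesis by (auto simp: K_def N)
qed

text \<open>A factor \<open>E 0\<close> with its nominal pole half a period from \<open>p\<close>
  turns a single factor into a product of two.\<close>

lemma single_pole:
  assumes R: "\<And>p q a b K. q - p \<notin> \<Lambda> \<Longrightarrow>
      R (poles p q) (\<lambda>z. K * (E a (z - p) * E b (q - z))) (K * V a b (q - p))"
    and V: "\<And>a w. w \<notin> \<Lambda> \<Longrightarrow> V a 0 w = \<delta> a"
  shows "\<exists>D G. R D G (K * \<delta> a) \<and> (\<forall>w. w \<notin> D \<longrightarrow> G w = K * E a (w - p))"
proof (intro exI conjI allI impI)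
  have generic: "(p + 1 / 2) - p \<notin> \<Lambda>" using half_not_in_lattice[OF Im_tau] by simp
  show "R (poles p (p + 1 / 2)) (\<lambda>z. K * (E a (z - p) * E 0 (p + 1 / 2 - z))) (K * \<delta> a)"
    using R[OF generic, of K a 0] V[OF generic, of a] by simp
  show "K * (E a (w - p) * E 0 (p + 1 / 2 - w)) = K * E a (w - p)" if "w \<notin> poles p (p + 1 / 2)" for w
    using that by (simp add: poles_def E_0)
qed

section \<open>Residues and regularized integrals of chains and loops\<close>

lemma has_holo_residue_poles:
  assumes "q - p \<notin> \<Lambda>"
  shows "has_holo_residue \<tau> (poles p q) (\<lambda>z. K * (E a (z - p) * E b (q - z))) (K * residue_value a b (q - p))"
proof -
  interpret two_poles \<tau> \<theta> p q by unfold_locales fact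
  show ?thesis by (rule has_holo_residue_E_E)
qed

lemma has_reg_integral_poles:
  assumes "q - p \<notin> \<Lambda>"
  shows "has_reg_integral \<tau> (poles p q) (\<lambda>z. K * (E a (z - p) * E b (q - z))) (K * integral_value a b (q - p))"
proof -
  interpret two_poles \<tau> \<theta> p q by unfold_locales fact
  show ?thesis by (rule has_reg_integral_E_E)
qed

lemma residue_value_0: "w \<notin> \<Lambda> \<Longrightarrow> residue_value a 0 w = of_bool (a = 1)"
  by (simp add: residue_value_def E_0)

lemma integral_value_0: "w \<notin> \<Lambda> \<Longrightarrow> integral_value a 0 w = of_bool (a = 0)"
  by (simp add: integral_value_def E_0)

lemma has_iterated_residue_loop:
  assumes "n \<ge> 2" "(\<Sum>k=1..n. c k) \<notin> \<Lambda>"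
  shows "has_iterated (has_holo_residue \<tau>) n (xi_loop \<tau> \<theta> n m c) z 0"
proof -
  \<comment> \<open>The two terms cancel or both vanish unless exactly one index is 1, so a multiple
    of a single function remains. Its precise form does not affect the result, as the last residue
    is that of a constant.\<close>
  have "\<exists>\<kappa> \<mu>. \<forall>w. residue_value a b w = \<kappa> * E \<mu> w" for a b
    unfolding residue_value_def
  proof (cases "a = 1 \<longleftrightarrow> b = 1")
    case True
    then show "\<exists>\<kappa> \<mu>. \<forall>w. of_bool (a = 1) * E b w - of_bool (b = 1) * E a w = \<kappa> * E \<mu> w"
      by (intro exI[of _ 0] exI) auto
  next
    case False
    then show "\<exists>\<kappa> \<mu>. \<forall>w. of_bool (a = 1) * E b w - of_bool (b = 1) * E a w = \<kappa> * E \<mu> w"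
      by (intro exI[of _ "if a = 1 then 1 else - 1"] exI[of _ "if a = 1 then b else a"]) auto
  qed
  then obtain \<kappa> \<mu> where \<kappa>\<mu>: "\<And>a b w. residue_value a b w = \<kappa> a b * E (\<mu> a b) w" by metis
  define st where "st = rec_nat (1, m n) (\<lambda>k s. (fst s * \<kappa> (m (k + 1)) (snd s), \<mu> (m (k + 1)) (snd s)))"
  have "has_iterated (has_holo_residue \<tau>) n (xi_loop \<tau> \<theta> n m c) z
      (fst (st (n - 1)) * E (snd (st (n - 1))) (\<Sum>k=1..n. c k) * 0)"
  proof (rule has_iterated_loop[where V = residue_value and \<alpha> = "\<lambda>k. fst (st k)" and M = "\<lambda>k. snd (st k)"])
    show "fst (st k) * residue_value (m (k + 1)) (snd (st k)) w = fst (st (k + 1)) * E (snd (st (k + 1))) w" for k w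
      unfolding \<kappa>\<mu> by (simp add: st_def)
  qed (use assms in \<open>auto simp: has_holo_residue_poles residue_value_0 st_def\<close>)
  then show ?thesis by simp
qed

lemma has_iterated_integral_loop:
  assumes "n \<ge> 2" "(\<Sum>k=1..n. c k) \<notin> \<Lambda>"
  shows "has_iterated (has_reg_integral \<tau>) n (xi_loop \<tau> \<theta> n m c) z
    (E (\<Sum>k=1..n. m k) (\<Sum>k=1..n. s_var n c z k) *
      ((\<Prod>k=1..n. of_bool (m k = 0)) - (\<Prod>k=1..n. (of_bool (m k = 0) - 1))))"
proof -
  obtain N where N: "n = Suc N" using assms(1) by (cases n) auto
  define M where "M k = m n + (\<Sum>j=1..k. m j)" for k
  \<comment> \<open>\<open>P\<close> records that all indices met so far are 0. Its companion
    \<open>Q\<close> is nonzero only if all are positive, and changes sign with each of them. Both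
    start from the factor with index \<open>n\<close>, which is already present before the first
    step.\<close>
  define P :: "nat \<Rightarrow> complex" where "P k = of_bool (m n = 0) * (\<Prod>j=1..k. of_bool (m j = 0))" for k
  define Q :: "nat \<Rightarrow> complex" where "Q k = (of_bool (m n = 0) - 1) * (\<Prod>j=1..k. of_bool (m j = 0) - 1)" for k
  have P: "P k = of_bool (M k = 0)" for k
    by (induction k) (auto simp: P_def M_def)
  have Q: "M k = 0 \<Longrightarrow> Q k = 0" for k
    by (auto simp: Q_def M_def)
  have "has_iterated (has_reg_integral \<tau>) n (xi_loop \<tau> \<theta> n m c) z
      ((P (n - 1) - Q (n - 1)) * E (M (n - 1)) (\<Sum>k=1..n. c k) * 1)"
  proof (rule has_iterated_loop[where V = integral_value and \<alpha> = "\<lambda>k. P k - Q k" and M = M])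
    \<comment> \<open>The two products begin as \<open>\<delta>\<close> and
      \<open>\<delta> - 1\<close>, so the initial scalar is 1 for either kind of
      \<open>m n\<close>.\<close>
    show "P 0 - Q 0 = 1" by (simp add: P_def Q_def)
    show "(P k - Q k) * integral_value (m (k + 1)) (M k) w = (P (k + 1) - Q (k + 1)) * E (M (k + 1)) w"
      for k w
    proof (cases "m (k + 1) = 0")
      case True
      then have "M (k + 1) = M k" "Q (k + 1) = 0" by (simp_all add: M_def Q_def)
      \<comment> \<open>A zero index lets only the state \<open>M k = 0\<close> survive, where
        \<open>Q k\<close> vanishes.\<close>
      with True Q[of k] show ?thesis by (simp add: P integral_value_def)
    next
      case False
      then have "M (k + 1) = m (k + 1) + M k" "Q (k + 1) = - Q k" by (simp_all add: M_def Q_def)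
      \<comment> \<open>A positive index lets only \<open>M k > 0\<close> survive, where
        \<open>P k\<close> vanishes; the minus sign of \<open>integral_value\<close> turns
        \<open>- Q k\<close> into \<open>Q k = - Q (k + 1)\<close>.\<close>
      with False Q[of k] show ?thesis by (simp add: P integral_value_def)
    qed
  qed (use assms in \<open>auto simp: M_def has_reg_integral_poles integral_value_0\<close>)
  moreover have "M (n - 1) = (\<Sum>k=1..n. m k)" "P (n - 1) = (\<Prod>k=1..n. of_bool (m k = 0))"
    "Q (n - 1) = (\<Prod>k=1..n. (of_bool (m k = 0) - 1))"
    by (simp_all add: N M_def P_def Q_def mult.commute)
  moreover have "(\<Sum>k=1..n. s_var n c z k) = (\<Sum>k=1..n. c k)"
    using assms(1) by (intro sum_s_var) simp
  ultimately show ?thesis by (simp add: mult.commute)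
qed

end

theorem proposition3p8:
  fixes \<tau> z0 :: complex and \<theta> :: "complex \<Rightarrow> complex"
    and n :: nat and m :: "nat \<Rightarrow> nat" and c z :: "nat \<Rightarrow> complex"
  assumes "Im \<tau> > 0" and "is_theta \<tau> \<theta>" and "n \<ge> 2"
    and "(\<Sum>k=1..n. c k) \<notin> lattice \<tau>"
  shows "has_iterated (has_holo_residue \<tau>) n (xi_chain \<tau> \<theta> n m c z0) z
           (\<Prod>k=1..n. of_bool (m k = 1)) \<and>
         has_iterated (has_holo_residue \<tau>) n (xi_loop \<tau> \<theta> n m c) z 0 \<and>
         has_iterated (has_reg_integral \<tau>) n (xi_chain \<tau> \<theta> n m c z0) z
           (\<Prod>k=1..n. of_bool (m k = 0)) \<and>
         has_iterated (has_reg_integral \<tau>) n (xi_loop \<tau> \<theta> n m c) z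
           (ehat \<tau> \<theta> (\<Sum>k=1..n. m k) (\<Sum>k=1..n. s_var n c z k) *
             ((\<Prod>k=1..n. of_bool (m k = 0)) - (\<Prod>k=1..n. (of_bool (m k = 0) - 1))))"
proof -
  interpret kronecker_eisenstein \<tau> \<theta> by unfold_locales (fact assms)+
  have n: "n \<ge> 1" using assms(3) by simp
  show ?thesis
  proof (intro conjI)
    show "has_iterated (has_holo_residue \<tau>) n (xi_chain \<tau> \<theta> n m c z0) z (\<Prod>k=1..n. of_bool (m k = 1))"
      by (rule has_iterated_chain[where \<delta> = "\<lambda>a. of_bool (a = 1)", OF single_pole n];
          fact has_holo_residue_poles residue_value_0)
    show "has_iterated (has_reg_integral \<tau>) n (xi_chain \<tau> \<theta> n m c z0) z (\<Prod>k=1..n. of_bool (m k = 0))"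
      by (rule has_iterated_chain[where \<delta> = "\<lambda>a. of_bool (a = 0)", OF single_pole n];
          fact has_reg_integral_poles integral_value_0)
  qed (fact has_iterated_residue_loop[OF assms(3,4)] has_iterated_integral_loop[OF assms(3,4)])+
qed

end
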